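(* Let $g_1,\ldots,g_m\in\mathbb{R}[x_1,\ldots,x_n]$ be concave polynomials, and let $$\mathbb{K}:=\{x\in\mathbb{R}^n \mid g_j(x)\ge 0,\ j=1,\ldots,m\}.$$ Assume that Slater's condition holds, i.e., there exists $x_0\in\mathbb{K}$ such that $g_j(x_0)>0$ for all $j=1,\ldots,m$. Let $f\in\mathbb{R}[x_1,\ldots,x_n]$ be convex, nonnegative on $\mathbb{K}$, and with a minimizer on $\mathbb{K}$, that is, there is some $x^*\in\mathbb{K}$ with $f(x^* )\le f(x)$ for all $x\in\mathbb{K}$. Then there exists a nonnegative vector $\lambda\in\mathbb{R}^m$ such that for every $\epsilon>0$ there is some $r_\epsilon\in\mathbb{N}$ for which $$f+\epsilon\sum_{k=0}^{r_\epsilon}\sum_{i=1}^n\frac{x_i^{2k}}{k!}=f_0+\sum_{j=1}^m\lambda_j\,g_j,$$ with $f_0\in\mathbb{R}[x_1,\ldots,x_n]$ a sum of squares. (Therefore, the degree of $f_0$ is at most $\max[2r_\epsilon,\deg f,\deg g_1,\ldots,\deg g_m]$.)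
   Context: A polynomial is a sum of squares if it is a finite sum of squares of polynomials in $\mathbb{R}[x_1,\ldots,x_n]$. Convex and concave are meant for the polynomials as functions on all of $\mathbb{R}^n$. The vector $\lambda$ does not depend on $\epsilon$. Here $\mathbb{N}=\{0,1,2,\ldots\}$, and $x_i^0=1$. *)

theory Defs
  imports "HOL-Analysis.Analysis" "HOL-Library.Poly_Mapping"
begin

text \<open>
  The polynomial ring \<open>\<real>[x\<^sub>1,\<dots>,x\<^sub>n]\<close> is the monoid algebra of the monomials
  \<open>'n \<Rightarrow>\<^sub>0 nat\<close> (exponent vectors) over the reals, with the variables indexed by a type \<open>'n\<close>.
  Its commutative ring structure, multiplication being convolution, comes from
  \<^theory>\<open>HOL-Library.Poly_Mapping\<close>.
\<close>

type_synonym 'n rpoly = "('n \<Rightarrow>\<^sub>0 nat) \<Rightarrow>\<^sub>0 real"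

definition Const :: "real \<Rightarrow> 'n rpoly" where
  "Const c = Poly_Mapping.single 0 c"

definition Var :: "'n \<Rightarrow> 'n rpoly" where
  "Var i = Poly_Mapping.single (Poly_Mapping.single i 1) 1"

definition eval :: "'n::finite rpoly \<Rightarrow> real ^ 'n \<Rightarrow> real" where
  "eval p x = (\<Sum>\<alpha>\<in>Poly_Mapping.keys p.
     Poly_Mapping.lookup p \<alpha> * (\<Prod>i\<in>UNIV. (x $ i) ^ Poly_Mapping.lookup \<alpha> i))"

text \<open>Total degree; the zero polynomial gets degree 0.\<close>

definition total_degree :: "'n::finite rpoly \<Rightarrow> nat" where
  "total_degree p =
     Max (insert 0 ((\<lambda>\<alpha>. \<Sum>i\<in>UNIV. Poly_Mapping.lookup \<alpha> i) ` Poly_Mapping.keys p))"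

definition sum_of_squares :: "'n rpoly \<Rightarrow> bool" where
  "sum_of_squares p \<longleftrightarrow> (\<exists>qs :: 'n rpoly list. p = (\<Sum>q\<leftarrow>qs. q ^ 2))"

definition feasible_set :: "nat \<Rightarrow> (nat \<Rightarrow> 'n::finite rpoly) \<Rightarrow> (real ^ 'n) set" where
  "feasible_set m g = {x. \<forall>j\<in>{1..m}. eval (g j) x \<ge> 0}"

end

(*
  Lagrange multipliers give l >= 0 such that p = f - sum l_j g_j is nonnegative on all of R^n, so it
  remains to turn a nonnegative p into a sum of squares by adding eps * sum x_i^(2k)/k!.

  A polynomial with coefficients c_a is absorbed by this perturbation as soon as the sum of
  |c_a| (|a|/2)! is small: split each monomial into x^b x^d, bound it by squares, and apply an
  AM-GM inequality that is itself certified by squares. Hence p only has to be approximated, in a weighted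
  l1 norm on coefficients, by sums of squares.

  Let q(u) = exp(-c u^2/2) sin(W u)/(W u). Integrating y^b q(x-y)^2 over y gives a polynomial of degree b
  in x whose coefficients are moments of q^2, and it tends to x^b (after normalisation) as W grows, since
  q^2 concentrates at 0. For c small, Cauchy's inequality bounds the Taylor coefficients in x of q(x-y) so
  well that truncating the Taylor series costs little in the weighted norm; replacing the
  integral by a Riemann sum leaves x^b ~ sum_j c_j y_j^b s_j(x)^2 for all b <= d at once, with c_j >= 0 and
  univariate polynomials s_j. Tensoring, p is approximated by the sum over all tuples of nodes of
  p(y_j1, ..., y_jn) prod_i c_ji s_ji(x_i)^2, whose coefficients are nonnegative because p is.
*)

theory Submission
  imports Defs "HOL-Complex_Analysis.Cauchy_Integral_Formula" "HOL-Probability.Distributions"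
begin

section \<open>Lagrange multipliers\<close>

text \<open>Every quotient \<open>f x / g x\<close> at a point with \<open>g x < 0\<close> lies
  below every such quotient at a point with \<open>g x > 0\<close>, so any nonnegative number
  between the two families is a multiplier. The point \<open>x0\<close> bounds the first family from
  above.\<close>

lemma lagrange_multiplier_one:
  fixes f g :: "'a::real_vector \<Rightarrow> real"
  assumes f: "convex_on C f" and g: "concave_on C g"
    and x0: "x0 \<in> C" "g x0 > 0"
    and nn: "\<And>x. x \<in> C \<Longrightarrow> g x \<ge> 0 \<Longrightarrow> f x \<ge> 0"
  obtains l where "l \<ge> 0" "\<And>x. x \<in> C \<Longrightarrow> f x \<ge> l * g x"
proof -
  have key: "f x / g x \<le> f x' / g x'" if x: "x \<in> C" "g x < 0" and x': "x' \<in> C" "g x' > 0" for x x'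
  proof -
    \<comment> \<open>\<open>t\<close> makes \<open>t * g x + (1 - t) * g x'\<close> vanish.
      Concavity then gives \<open>g z \<ge> 0\<close>, hence \<open>f z \<ge> 0\<close>, and
      convexity bounds \<open>f z\<close> by a positive multiple of the cross-multiplied difference
      of the two quotients.\<close>
    define D t where "D = g x' - g x" and "t = g x' / D"
    have D: "D > 0" and t: "t \<ge> 0" "1 - t \<ge> 0" and t1: "1 - t = - g x / D"
      using x x' by (auto simp: D_def t_def field_simps)
    define z where "z = t *\<^sub>R x + (1 - t) *\<^sub>R x'"
    have zC: "z \<in> C"
      using convex_on_imp_convex[OF f] x x' t by (auto simp: z_def convex_def)
    have "g z \<ge> t * g x + (1 - t) * g x'"
      using g x x' t unfolding concave_on_iff z_def by auto
    also have "t * g x + (1 - t) * g x' = 0"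
      using D unfolding t1 by (simp add: t_def field_simps)
    finally have "0 \<le> f z" using nn zC by simp
    also have "f z \<le> t * f x + (1 - t) * f x'"
      using f x x' t unfolding convex_on_def z_def by auto
    also have "\<dots> = (g x' * f x - g x * f x') / D"
      using D unfolding t1 by (simp add: t_def field_simps)
    finally have "g x' * f x - g x * f x' \<ge> 0"
      using D by (simp add: zero_le_divide_iff)
    then show ?thesis
      using x x' by (simp add: field_simps)
  qed
  \<comment> \<open>The element 0 makes the supremum nonnegative and keeps the set nonempty when
    \<open>g\<close> has no negative value. It lies below the quotients with \<open>g x' > 0\<close>
    because \<open>f\<close> is nonnegative there.\<close>
  define S where "S = insert 0 ((\<lambda>x. f x / g x) ` {x \<in> C. g x < 0})"
  have ub: "s \<le> f x' / g x'" if "s \<in> S" "x' \<in> C" "g x' > 0" for s x'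
    using that key nn[of x'] by (auto simp: S_def)
  have bdd: "bdd_above S" using ub x0 by (auto simp: bdd_above_def)
  show ?thesis
  proof
    show "Sup S \<ge> 0" by (rule cSup_upper) (use bdd in \<open>auto simp: S_def\<close>)
    fix x assume x: "x \<in> C"
    consider "g x = 0" | "g x > 0" | "g x < 0" by linarith
    then show "f x \<ge> Sup S * g x"
    proof cases
      case 1 then show ?thesis using nn x by simp
    next
      case 2
      have "Sup S \<le> f x / g x"
        by (rule cSup_least) (use ub x 2 in \<open>auto simp: S_def\<close>)
      then show ?thesis using 2 by (simp add: field_simps)
    next
      case 3
      have "f x / g x \<le> Sup S"
        by (rule cSup_upper) (use bdd x 3 in \<open>auto simp: S_def\<close>)
      then show ?thesis using 3 by (simp add: field_simps)
    qed
  qed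
qed

text \<open>Constraints are removed one at a time, the last first. The one-constraint lemma, applied
  on the convex set cut out by the first \<open>m\<close> constraints, yields \<open>k\<close>; then
  \<open>f x - k * g (Suc m) x\<close> is convex on all of \<open>C\<close> and nonnegative under
  those \<open>m\<close> constraints, so it is a new objective for the induction hypothesis.\<close>

lemma lagrange_multipliers:
  fixes f :: "'a::real_vector \<Rightarrow> real" and g :: "nat \<Rightarrow> 'a \<Rightarrow> real"
  assumes "convex_on C f" "\<And>j. j \<in> {1..m} \<Longrightarrow> concave_on C (g j)"
    and "z \<in> C" "\<And>j. j \<in> {1..m} \<Longrightarrow> g j z > 0"
    and "\<And>x. x \<in> C \<Longrightarrow> (\<And>j. j \<in> {1..m} \<Longrightarrow> g j x \<ge> 0) \<Longrightarrow> f x \<ge> 0"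
  shows "\<exists>l. (\<forall>j. l j \<ge> 0) \<and> (\<forall>x\<in>C. f x \<ge> (\<Sum>j=1..m. l j * g j x))"
  using assms
proof (induction m arbitrary: f)
  case 0
  then show ?case by (intro exI[of _ "\<lambda>_. 0"]) auto
next
  case (Suc m)
  define C' where "C' = {x \<in> C. \<forall>j\<in>{1..m}. g j x \<ge> 0}"
  have "convex C'"
    unfolding convex_def
  proof (intro ballI allI impI)
    fix x y and u v :: real
    assume *: "x \<in> C'" "y \<in> C'" "0 \<le> u" "0 \<le> v" "u + v = 1"
    have "u *\<^sub>R x + v *\<^sub>R y \<in> C"
      using convex_on_imp_convex[OF Suc.prems(1)] * by (auto simp: convex_def C'_def)
    moreover have "g j (u *\<^sub>R x + v *\<^sub>R y) \<ge> 0" if j: "j \<in> {1..m}" for j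
    proof -
      have "g j (u *\<^sub>R x + v *\<^sub>R y) \<ge> u * g j x + v * g j y"
        using Suc.prems(2)[of j] j * unfolding concave_on_iff C'_def by auto
      moreover have "g j x \<ge> 0" "g j y \<ge> 0" using j * by (auto simp: C'_def)
      ultimately show ?thesis using * by (smt (verit) mult_nonneg_nonneg)
    qed
    ultimately show "u *\<^sub>R x + v *\<^sub>R y \<in> C'" by (auto simp: C'_def)
  qed
  then have C': "convex_on C' f" "concave_on C' (g (Suc m))"
    using Suc.prems(1) Suc.prems(2)[of "Suc m"] unfolding concave_on_def
    by (auto simp: C'_def intro: convex_on_subset)
  obtain k where k: "k \<ge> 0" "\<And>x. x \<in> C' \<Longrightarrow> f x \<ge> k * g (Suc m) x"
  proof (rule lagrange_multiplier_one[OF C'])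
    show "z \<in> C'" using Suc.prems(3,4) by (auto simp: C'_def intro!: less_imp_le)
    show "g (Suc m) z > 0" using Suc.prems(4)[of "Suc m"] by simp
    show "f x \<ge> 0" if "x \<in> C'" "g (Suc m) x \<ge> 0" for x
      by (rule Suc.prems(5)) (use that in \<open>auto simp: C'_def le_Suc_eq\<close>)
  qed blast
  have "\<exists>l. (\<forall>j. l j \<ge> 0) \<and> (\<forall>x\<in>C. f x - k * g (Suc m) x \<ge> (\<Sum>j=1..m. l j * g j x))"
  proof (rule Suc.IH)
    show "convex_on C (\<lambda>x. f x - k * g (Suc m) x)"
      using Suc.prems(1) Suc.prems(2)[of "Suc m"] k(1)
      by (intro convex_on_diff concave_on_cmul) auto
    show "f x - k * g (Suc m) x \<ge> 0" if "x \<in> C" "\<And>j. j \<in> {1..m} \<Longrightarrow> g j x \<ge> 0" for x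
      using k(2)[of x] that by (auto simp: C'_def)
  qed (use Suc.prems in auto)
  then obtain l where l: "\<forall>j. l j \<ge> 0" "\<forall>x\<in>C. f x - k * g (Suc m) x \<ge> (\<Sum>j=1..m. l j * g j x)"
    by blast
  show ?case
    using l k by (intro exI[of _ "l(Suc m := k)"]) (auto simp: algebra_simps)
qed

section \<open>Polynomials and sums of squares\<close>

lemma Const_0 [simp]: "Const 0 = 0" and Const_1 [simp]: "Const 1 = 1"
  and Const_add: "Const (a + b) = Const a + Const b"
  and Const_diff: "Const (a - b) = Const a - Const b"
  and Const_uminus: "Const (- a) = - Const a"
  and Const_mult: "Const (a * b) = Const a * Const b"
  by (simp_all add: Const_def single_add single_diff single_uminus mult_single)

lemma Const_power: "Const (a ^ k) = Const a ^ k"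
  by (induction k) (simp_all add: Const_mult)

lemma Const_sum: "Const (sum f A) = (\<Sum>x\<in>A. Const (f x))"
  by (induction A rule: infinite_finite_induct) (simp_all add: Const_add)

lemma Const_prod: "Const (prod f A) = (\<Prod>x\<in>A. Const (f x))"
  by (induction A rule: infinite_finite_induct) (simp_all add: Const_mult)

lemma Var_power: "Var i ^ k = Poly_Mapping.single (Poly_Mapping.single i k) 1"
  by (induction k) (simp_all add: Var_def mult_single flip: single_add)

lemma prod_Var_power:
  "(\<Prod>i\<in>A. Var i ^ a i) = Poly_Mapping.single (\<Sum>i\<in>A. Poly_Mapping.single i (a i)) 1"
  by (induction A rule: infinite_finite_induct) (simp_all add: Var_power mult_single)

lemma sum_single_lookup:
  fixes p :: "'a::finite \<Rightarrow>\<^sub>0 'b::comm_monoid_add"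
  shows "(\<Sum>i\<in>UNIV. Poly_Mapping.single i (Poly_Mapping.lookup p i)) = p"
  by (rule poly_mapping_eqI) (simp add: lookup_sum lookup_single when_def)

lemma rpoly_eq_sum_monomials:
  fixes p :: "'n::finite rpoly"
  shows "p = (\<Sum>\<alpha>\<in>Poly_Mapping.keys p.
    Const (Poly_Mapping.lookup p \<alpha>) * (\<Prod>i\<in>UNIV. Var i ^ Poly_Mapping.lookup \<alpha> i))"
  by (rule poly_mapping_eqI)
    (auto simp: prod_Var_power sum_single_lookup Const_def mult_single lookup_sum lookup_single
      when_def in_keys_iff)

lemma eval_superset:
  assumes "finite A" "Poly_Mapping.keys p \<subseteq> A"
  shows "eval p x = (\<Sum>\<alpha>\<in>A. Poly_Mapping.lookup p \<alpha> * (\<Prod>i\<in>UNIV. (x $ i) ^ Poly_Mapping.lookup \<alpha> i))"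
  unfolding eval_def using assms by (intro sum.mono_neutral_left) (auto simp: in_keys_iff)

lemma eval_0 [simp]: "eval 0 x = 0"
  by (simp add: eval_def)

lemma eval_add: "eval (p + q) x = eval p x + eval q x"
proof -
  let ?A = "Poly_Mapping.keys p \<union> Poly_Mapping.keys q"
  show ?thesis
    using keys_add[of p q]
    by (simp add: eval_superset[of ?A] lookup_add distrib_right sum.distrib)
qed

lemma lookup_Const_mult: "Poly_Mapping.lookup (Const c * p) \<alpha> = c * Poly_Mapping.lookup p \<alpha>"
  by (simp add: Const_def Poly_Mapping.map.rep_eq when_def flip: mult_map_scale_conv_mult)

lemma keys_Const_mult: "Poly_Mapping.keys (Const c * p) \<subseteq> Poly_Mapping.keys p"
  by (auto simp: in_keys_iff lookup_Const_mult)

lemma eval_Const_mult: "eval (Const c * p) x = c * eval p x"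
  unfolding eval_superset[OF finite_keys keys_Const_mult]
  by (simp add: lookup_Const_mult eval_def sum_distrib_left mult.assoc)

lemma eval_diff: "eval (p - q) x = eval p x - eval q x"
  using eval_add[of "p - q" q x] by simp

lemma eval_sum: "eval (sum p A) x = (\<Sum>a\<in>A. eval (p a) x)"
  by (induction A rule: infinite_finite_induct) (simp_all add: eval_add)

lemma total_degree_le_iff:
  "total_degree p \<le> d \<longleftrightarrow> (\<forall>\<alpha>\<in>Poly_Mapping.keys p. (\<Sum>i\<in>UNIV. Poly_Mapping.lookup \<alpha> i) \<le> d)"
  by (auto simp: total_degree_def)

lemma total_degree_add_le:
  assumes "total_degree p \<le> d" "total_degree q \<le> d"
  shows "total_degree (p + q) \<le> d"
  using assms keys_add[of p q] unfolding total_degree_le_iff by blast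

lemma total_degree_Const_mult_le:
  assumes "total_degree p \<le> d"
  shows "total_degree (Const c * p) \<le> d"
  using assms keys_Const_mult[of c p] unfolding total_degree_le_iff by blast

lemma total_degree_sum_le:
  assumes "\<And>a. a \<in> A \<Longrightarrow> total_degree (p a) \<le> d"
  shows "total_degree (sum p A) \<le> d"
  using assms
  by (induction A rule: infinite_finite_induct)
    (auto intro: total_degree_add_le simp: total_degree_le_iff[of 0])

lemma total_degree_diff_le:
  assumes "total_degree p \<le> d" "total_degree q \<le> d"
  shows "total_degree (p - q) \<le> d"
proof -
  have "p - q = p + Const (-1) * q" by (simp add: Const_uminus)
  then show ?thesis
    using assms total_degree_add_le total_degree_Const_mult_le by metis
qed

lemma total_degree_Var_power_le: "total_degree (Var i ^ k) \<le> k"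
  by (auto simp: total_degree_le_iff Var_power lookup_single when_def)

section \<open>The cone of sums of squares and certified AM-GM inequalities\<close>

lemma sum_of_squares_0 [simp]: "sum_of_squares 0"
  unfolding sum_of_squares_def by (rule exI[of _ "[]"]) simp

lemma sum_of_squares_square: "sum_of_squares (p ^ 2)"
  unfolding sum_of_squares_def by (rule exI[of _ "[p]"]) simp

lemma sum_of_squares_add:
  assumes "sum_of_squares p" "sum_of_squares q"
  shows "sum_of_squares (p + q)"
proof -
  obtain ps qs where "p = (\<Sum>q\<leftarrow>ps. q ^ 2)" "q = (\<Sum>q\<leftarrow>qs. q ^ 2)"
    using assms by (auto simp: sum_of_squares_def)
  then show ?thesis unfolding sum_of_squares_def by (intro exI[of _ "ps @ qs"]) simp
qed

lemma sum_of_squares_mult_square: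
  assumes "sum_of_squares p"
  shows "sum_of_squares (q ^ 2 * p)"
proof -
  obtain ps where "p = (\<Sum>q\<leftarrow>ps. q ^ 2)"
    using assms by (auto simp: sum_of_squares_def)
  then show ?thesis
    unfolding sum_of_squares_def
    by (intro exI[of _ "map ((*) q) ps"])
      (simp add: sum_list_const_mult[symmetric] power_mult_distrib o_def)
qed

lemma sum_of_squares_mult:
  assumes "sum_of_squares p" "sum_of_squares q"
  shows "sum_of_squares (p * q)"
proof -
  obtain ps where p: "p = (\<Sum>q\<leftarrow>ps. q ^ 2)"
    using assms(1) by (auto simp: sum_of_squares_def)
  show ?thesis
    unfolding p
    by (induction ps)
      (auto simp: distrib_right intro: sum_of_squares_add sum_of_squares_mult_square assms(2))
qed

lemma sum_of_squares_Const: "c \<ge> 0 \<Longrightarrow> sum_of_squares (Const c)"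
  using sum_of_squares_square[of "Const (sqrt c)"] by (simp flip: Const_power)

lemma sum_of_squares_sum:
  "(\<And>a. a \<in> A \<Longrightarrow> sum_of_squares (p a)) \<Longrightarrow> sum_of_squares (sum p A)"
  by (induction A rule: infinite_finite_induct) (auto intro: sum_of_squares_add)

lemma sum_of_squares_prod:
  "(\<And>a. a \<in> A \<Longrightarrow> sum_of_squares (p a)) \<Longrightarrow> sum_of_squares (prod p A)"
  using sum_of_squares_Const[of 1]
  by (induction A rule: infinite_finite_induct) (auto intro: sum_of_squares_mult)

lemma sum_of_squares_even_power: "sum_of_squares (p ^ (2 * k))"
  using sum_of_squares_square[of "p ^ k"] by (simp add: power_mult power2_eq_square mult.commute)

text \<open>With \<open>A = a ^ 2\<close> and \<open>B = b ^ 2\<close> the polynomial is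
  \<open>(A ^ j - B ^ j) * (A ^ k - B ^ k) + A ^ k * B ^ j\<close>. Both differences are divisible
  by \<open>A - B\<close> with cofactors having nonnegative coefficients, so their product is
  \<open>(A - B) ^ 2\<close> times a sum of squares.\<close>

lemma sum_of_squares_two_var_amgm:
  "sum_of_squares (a ^ (2 * (j + k)) + b ^ (2 * (j + k)) - a ^ (2 * j) * b ^ (2 * k))"
proof -
  define A B where "A = a ^ 2" and "B = b ^ 2"
  have eq: "(A ^ j - B ^ j) * (A ^ k - B ^ k)
    = (A - B) ^ 2 * ((\<Sum>i<j. B ^ (j - Suc i) * A ^ i) * (\<Sum>i<k. B ^ (k - Suc i) * A ^ i))"
    by (simp add: power_diff_sumr2 power2_eq_square mult_ac)
  have "sum_of_squares (A ^ i)" "sum_of_squares (B ^ i)" for i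
    by (simp_all add: A_def B_def sum_of_squares_even_power flip: power_mult)
  then have "sum_of_squares ((A ^ j - B ^ j) * (A ^ k - B ^ k) + A ^ k * B ^ j)"
    unfolding eq
    by (intro sum_of_squares_add sum_of_squares_mult_square sum_of_squares_mult sum_of_squares_sum)
  also have "(A ^ j - B ^ j) * (A ^ k - B ^ k) + A ^ k * B ^ j
    = A ^ (j + k) + B ^ (j + k) - A ^ j * B ^ k"
    by (simp add: algebra_simps power_add)
  finally show ?thesis by (simp only: A_def B_def power_mult [symmetric])
qed

text \<open>AM-GM with a crude constant, by induction: the hypothesis for \<open>S\<close> is
  multiplied by the square \<open>X i ^ (2 * b i)\<close>, and each resulting mixed term
  \<open>X i ^ (2 * b i) * X k ^ (2 * sum b S)\<close> is bounded by the two-variable case.\<close>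

lemma sum_of_squares_amgm:
  fixes X :: "'a \<Rightarrow> 'n rpoly"
  assumes "finite S" "S \<noteq> {}"
  shows "sum_of_squares (Const (fact (card S)) * (\<Sum>i\<in>S. X i ^ (2 * sum b S)) - (\<Prod>i\<in>S. X i ^ (2 * b i)))"
  using assms
proof (induction S rule: finite_ne_induct)
  case (singleton i)
  then show ?case by simp
next
  case (insert i S)
  define B where "B = sum b S"
  define s where "s = card S"
  define Y where "Y k = X k ^ (2 * (b i + B))" for k
  have 1: "sum_of_squares (X i ^ (2 * b i) *
    (Const (fact s) * (\<Sum>k\<in>S. X k ^ (2 * B)) - (\<Prod>k\<in>S. X k ^ (2 * b k))))"
    using insert.IH by (intro sum_of_squares_mult sum_of_squares_even_power) (simp add: B_def s_def)
  have 2: "sum_of_squares (Const (fact s) * (\<Sum>k\<in>S. Y i + Y k - X i ^ (2 * b i) * X k ^ (2 * B)))"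
    unfolding Y_def
    by (intro sum_of_squares_mult sum_of_squares_sum sum_of_squares_Const sum_of_squares_two_var_amgm) auto
  have s1: "s \<ge> 1" using insert by (simp add: s_def Suc_le_eq card_gt_0_iff)
  have f: "fact (Suc s) - fact s * real s = fact s" "fact (Suc s) - fact s = fact s * real s"
    by (simp_all add: algebra_simps)
  \<comment> \<open>These are the pure powers left over: out of \<open>fact (Suc s)\<close> copies
    each, the two-variable bounds use \<open>fact s * s\<close> copies of \<open>Y i\<close> and
    \<open>fact s\<close> copies of each \<open>Y k\<close>.\<close>
  have 3: "sum_of_squares (Const (fact s) * Y i + Const (fact s * real s) * (\<Sum>k\<in>S. Y k))"
    unfolding Y_def
    by (intro sum_of_squares_add sum_of_squares_mult sum_of_squares_sum sum_of_squares_Const 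
        sum_of_squares_even_power) auto
  have nat: "(of_nat s :: 'n rpoly) = Const (real s)"
    by (simp add: Const_def flip: single_of_nat)
  have "Const (fact (Suc s)) * (Y i + (\<Sum>k\<in>S. Y k)) - X i ^ (2 * b i) * (\<Prod>k\<in>S. X k ^ (2 * b k))
    = X i ^ (2 * b i) * (Const (fact s) * (\<Sum>k\<in>S. X k ^ (2 * B)) - (\<Prod>k\<in>S. X k ^ (2 * b k)))
    + Const (fact s) * (\<Sum>k\<in>S. Y i + Y k - X i ^ (2 * b i) * X k ^ (2 * B))
    + (Const (fact s) * Y i + Const (fact s * real s) * (\<Sum>k\<in>S. Y k))"
    by (simp add: algebra_simps sum.distrib sum_subtractf Const_add Const_mult nat
        sum_distrib_left sum_distrib_right s_def[symmetric])
  also have "sum_of_squares \<dots>" by (rule sum_of_squares_add[OF sum_of_squares_add[OF 1 2] 3])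
  finally show ?case using insert.hyps by (simp add: B_def Y_def s_def)
qed

section \<open>Polynomials absorbed by the perturbation\<close>

definition power_sum :: "nat \<Rightarrow> 'n::finite rpoly" where
  "power_sum k = (\<Sum>i\<in>UNIV. Var i ^ (2 * k))"

definition perturbation :: "nat \<Rightarrow> 'n::finite rpoly" where
  "perturbation r = (\<Sum>k=0..r. Const (1 / fact k) * power_sum k)"

lemma sum_of_squares_power_sum: "sum_of_squares (power_sum k)"
  unfolding power_sum_def by (intro sum_of_squares_sum sum_of_squares_even_power)

text \<open>The layer \<open>k\<close> of the perturbation alone dominates
  \<open>b * power_sum k\<close>; the other layers are themselves sums of squares.\<close>

lemma sum_of_squares_perturbation_minus_power_sum:
  assumes "k \<le> r" "b \<ge> 0" "b * fact k \<le> a"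
  shows "sum_of_squares (Const a * perturbation r - Const b * power_sum k :: 'n::finite rpoly)"
proof -
  have a: "a \<ge> 0" using assms by (smt (verit) mult_nonneg_nonneg fact_ge_zero)
  have "(perturbation r :: 'n rpoly) = Const (1 / fact k) * power_sum k
      + (\<Sum>j\<in>{0..r}-{k}. Const (1 / fact j) * power_sum j)"
    unfolding perturbation_def using assms by (subst sum.remove[of _ k]) auto
  moreover have "Const (a / fact k) = Const a * (Const (1 / fact k) :: 'n rpoly)"
    by (simp flip: Const_mult)
  ultimately have "Const a * perturbation r - Const b * power_sum k = Const (a / fact k - b) * power_sum k
      + Const a * (\<Sum>j\<in>{0..r}-{k}. Const (1 / fact j) * power_sum j :: 'n rpoly)"
    by (simp add: algebra_simps Const_diff)
  also have "sum_of_squares \<dots>"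
    by (intro sum_of_squares_add sum_of_squares_mult sum_of_squares_sum sum_of_squares_Const 
        sum_of_squares_power_sum) (use a assms in \<open>auto simp: field_simps\<close>)
  finally show ?thesis .
qed

text \<open>Demanding the property for all large \<open>r\<close>, not just for one, lets finitely
  many absorbed polynomials share an \<open>r\<close>, so that their costs \<open>e\<close> add
  up.\<close>

definition absorbed :: "real \<Rightarrow> 'n::finite rpoly \<Rightarrow> bool" where
  "absorbed e q \<longleftrightarrow> e \<ge> 0 \<and> (\<exists>r0. \<forall>r\<ge>r0. sum_of_squares (q + Const e * perturbation r))"

text \<open>The exponents are halved, \<open>a = b + d\<close> with \<open>b\<close> rounded down
  and \<open>d\<close> rounded up. Up to a square, \<open>c * mon a\<close> is minus
  \<open>\<bar>c\<bar> / 2\<close> times the even monomials with exponents \<open>2 * b i\<close>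
  and \<open>2 * d i\<close>. The AM-GM certificate bounds these by power sums, whose coefficients
  in the perturbation are reciprocal factorials; hence the factorial of the half degree in the
  cost.\<close>

lemma absorbed_monomial:
  fixes a :: "'n::finite \<Rightarrow> nat"
  defines "K \<equiv> fact CARD('n)"
  assumes e: "e \<ge> K * fact (\<Sum>i\<in>UNIV. (a i + 1) div 2) * \<bar>c\<bar>"
  shows "absorbed e (Const c * (\<Prod>i\<in>UNIV. Var i ^ a i) :: 'n rpoly)"
proof -
  define b d where "b i = a i div 2" and "d i = (a i + 1) div 2" for i
  have bd: "a i = b i + d i" "b i \<le> d i" for i by (auto simp: b_def d_def)
  define mon :: "('n \<Rightarrow> nat) \<Rightarrow> 'n rpoly" where "mon v = (\<Prod>i\<in>UNIV. Var i ^ v i)" for v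
  have mon_mult: "mon v * mon w = mon (\<lambda>i. v i + w i)" for v w
    by (simp add: mon_def power_add prod.distrib)
  have K: "K \<ge> 1" by (simp add: K_def)
  have e0: "e \<ge> 0" using e K by (smt (verit) mult_nonneg_nonneg fact_ge_zero abs_ge_zero)
  have amgm: "sum_of_squares (Const K * power_sum (sum v UNIV) - mon (\<lambda>i. 2 * v i))" for v
    using sum_of_squares_amgm[of UNIV Var v] by (simp add: K_def power_sum_def mon_def)
  have "sum_of_squares (Const c * mon a + Const e * perturbation r)" if r: "r \<ge> sum d UNIV" for r
  proof -
    define h where "h = \<bar>c\<bar> / 2"
    have h: "h \<ge> 0" by (simp add: h_def)
    \<comment> \<open>Half of \<open>e\<close> pays for each of the two power sums, with
      \<open>v = b\<close> and \<open>v = d\<close>. The factorial is monotone, so the larger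
      exponents \<open>d\<close> determine the requirement on \<open>e\<close>.\<close>
    have bound: "sum_of_squares (Const (e / 2) * perturbation r - Const (h * K) * power_sum (sum v UNIV) :: 'n rpoly)"
      if v: "\<And>i. v i \<le> d i" for v
    proof (rule sum_of_squares_perturbation_minus_power_sum)
      have le: "sum v UNIV \<le> sum d UNIV" by (rule sum_mono) (use v in auto)
      then show "sum v UNIV \<le> r" using r by simp
      show "h * K \<ge> 0" using h K by simp
      have "h * K * fact (sum v UNIV) \<le> h * K * fact (sum d UNIV)"
        using h K le by (intro mult_left_mono fact_mono) auto
      also have "\<dots> \<le> e / 2" using e by (simp add: h_def d_def mult_ac)
      finally show "h * K * fact (sum v UNIV) \<le> e / 2" .
    qed
    have sq: "(mon b + Const (sgn c) * mon d) ^ 2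
      = mon (\<lambda>i. 2 * b i) + Const (2 * sgn c) * mon a + Const (sgn c ^ 2) * mon (\<lambda>i. 2 * d i)"
    proof -
      have "mon b * mon b = mon (\<lambda>i. 2 * b i)" "mon d * mon d = mon (\<lambda>i. 2 * d i)"
        "mon b * mon d = mon a"
        by (simp_all add: mon_mult bd(1)[abs_def] mult_2)
      note m = this[symmetric]
      have "Const (2 * sgn c) = Const (sgn c) + (Const (sgn c) :: 'n rpoly)"
        by (simp flip: Const_add)
      moreover have "Const (sgn c ^ 2) = Const (sgn c) * (Const (sgn c) :: 'n rpoly)"
        by (simp only: power2_eq_square Const_mult)
      ultimately show ?thesis
        unfolding m by (simp only: power2_eq_square) (simp add: algebra_simps)
    qed
    \<comment> \<open>The second equation survives \<open>c = 0\<close>, where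
      \<open>sgn c = 0\<close>, because then \<open>h = 0\<close> as well.\<close>
    have h2: "h * 2 * sgn c = c" "h * sgn c ^ 2 = h"
      by (auto simp: h_def sgn_if)
    have "Const c * mon a + Const e * perturbation r = 
       Const h * (mon b + Const (sgn c) * mon d) ^ 2
       + (Const h * (Const K * power_sum (sum b UNIV) - mon (\<lambda>i. 2 * b i))
          + Const h * (Const K * power_sum (sum d UNIV) - mon (\<lambda>i. 2 * d i)))
       + ((Const (e / 2) * perturbation r - Const (h * K) * power_sum (sum b UNIV))
          + (Const (e / 2) * perturbation r - Const (h * K) * power_sum (sum d UNIV)))"
    proof -
      have "Const e = Const (e/2) + (Const (e/2) :: 'n rpoly)" by (simp flip: Const_add)
      then show ?thesis
        unfolding sq by (simp add: distrib_left distrib_right right_diff_distrib h2 mult.assoc[symmetric] flip: Const_mult)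
    qed
    also have "sum_of_squares \<dots>"
      by (intro sum_of_squares_add sum_of_squares_mult sum_of_squares_Const h sum_of_squares_square
          amgm bound) (use bd in auto)
    finally show ?thesis .
  qed
  then show ?thesis using e0 unfolding absorbed_def mon_def by blast
qed

lemma absorbed_0 [simp]: "absorbed 0 0"
  by (simp add: absorbed_def)

lemma absorbed_add:
  assumes "absorbed a p" "absorbed b q"
  shows "absorbed (a + b) (p + q)"
proof -
  obtain r s where "\<And>k. k \<ge> r \<Longrightarrow> sum_of_squares (p + Const a * perturbation k)"
     "\<And>k. k \<ge> s \<Longrightarrow> sum_of_squares (q + Const b * perturbation k)"
    using assms unfolding absorbed_def by blast
  then have "sum_of_squares ((p + Const a * perturbation k) + (q + Const b * perturbation k))"
    if "k \<ge> max r s" for k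
    by (rule sum_of_squares_add) (use that in auto)
  then have "\<forall>k\<ge>max r s. sum_of_squares (p + q + Const (a + b) * perturbation k)"
    by (simp add: algebra_simps Const_add)
  then show ?thesis using assms unfolding absorbed_def by (meson add_nonneg_nonneg)
qed

lemma absorbed_sum:
  "(\<And>x. x \<in> A \<Longrightarrow> absorbed (e x) (p x)) \<Longrightarrow> absorbed (sum e A) (sum p A)"
  by (induction A rule: infinite_finite_induct) (auto intro: absorbed_add)

lemma absorbed_mono:
  assumes "absorbed a p" "a \<le> b"
  shows "absorbed b p"
proof -
  obtain r where "\<And>k. k \<ge> r \<Longrightarrow> sum_of_squares (p + Const a * perturbation k)"
    using assms unfolding absorbed_def by blast
  moreover have "sum_of_squares (Const (b - a) * perturbation k :: 'a rpoly)" for k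
    unfolding perturbation_def using assms
    by (intro sum_of_squares_mult sum_of_squares_sum sum_of_squares_Const sum_of_squares_power_sum) auto
  ultimately have "sum_of_squares ((p + Const a * perturbation k) + Const (b - a) * perturbation k)"
    if "k \<ge> r" for k by (rule sum_of_squares_add) (use that in auto)
  then have "\<forall>k\<ge>r. sum_of_squares (p + Const b * perturbation k)"
    by (simp add: algebra_simps Const_diff)
  then show ?thesis using assms unfolding absorbed_def by auto
qed

section \<open>Coefficients of squares, factorial estimates and weighted approximation of
  monomials\<close>

definition sq_coeff :: "(nat \<Rightarrow> real) \<Rightarrow> nat \<Rightarrow> real" where
  "sq_coeff s l = (\<Sum>k\<le>l. s k * s (l - k))"

lemma power2_sum_powers:
  fixes x :: "'n rpoly"
  assumes s: "\<And>l. l > T \<Longrightarrow> s l = 0"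
  shows "(\<Sum>l\<le>T. Const (s l) * x ^ l) ^ 2 = (\<Sum>l\<le>2 * T. Const (sq_coeff s l) * x ^ l)"
proof -
  have "(\<Sum>l\<le>T. Const (s l) * x ^ l) ^ 2
    = (\<Sum>(i, j)\<in>{..T} \<times> {..T}. Const (s i * s j) * x ^ (i + j))"
    by (simp add: power2_eq_square sum_product sum.cartesian_product Const_mult power_add mult_ac)
  \<comment> \<open>The square of index pairs is enlarged to a triangle; each new pair has an index
    above \<open>T\<close> and contributes 0.\<close>
  also have "\<dots> = (\<Sum>(i, j)\<in>{(i, j). i + j \<le> 2 * T}. Const (s i * s j) * x ^ (i + j))"
  proof (rule sum.mono_neutral_left)
    show "finite {(i, j). i + j \<le> 2 * T}"
      by (rule finite_subset[of _ "{..2 * T} \<times> {..2 * T}"]) auto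
    show "\<forall>z\<in>{(i, j). i + j \<le> 2 * T} - {..T} \<times> {..T}.
        (case z of (i, j) \<Rightarrow> Const (s i * s j) * x ^ (i + j)) = 0"
    proof -
      have "s i * s j = 0" if "\<not> (i \<le> T \<and> j \<le> T)" for i j
        using that s[of i] s[of j] by (auto simp: not_le)
      note zero = this
      show ?thesis
      proof
        fix z assume z: "z \<in> {(i, j). i + j \<le> 2 * T} - {..T} \<times> {..T}"
        obtain i j where ij: "z = (i, j)" by (cases z)
        with z zero[of i j] have "s i * s j = 0" by auto
        then show "(case z of (i, j) \<Rightarrow> Const (s i * s j) * x ^ (i + j)) = 0" by (auto simp: ij)
      qed
    qed
  qed auto
  also have "\<dots> = (\<Sum>l\<le>2 * T. \<Sum>k\<le>l. Const (s k * s (l - k)) * x ^ (k + (l - k)))"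
    by (rule sum.triangle_reindex_eq)
  also have "\<dots> = (\<Sum>l\<le>2 * T. Const (sq_coeff s l) * x ^ l)"
    by (simp add: sq_coeff_def Const_sum sum_distrib_right)
  finally show ?thesis .
qed

text \<open>Writing each \<open>a i\<close> as \<open>b i + (a i - b i)\<close> explains the bound:
  the term without any error cancels, and all others occur on the right in absolute value. The
  right-hand side is kept as a difference of products so that it factors again after summation over
  exponent vectors.\<close>

lemma abs_prod_diff_le:
  fixes a b :: "'i \<Rightarrow> real"
  assumes "finite A"
  shows "\<bar>(\<Prod>i\<in>A. a i) - (\<Prod>i\<in>A. b i)\<bar>
    \<le> (\<Prod>i\<in>A. \<bar>b i\<bar> + \<bar>a i - b i\<bar>) - (\<Prod>i\<in>A. \<bar>b i\<bar>)"
  using assms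
proof (induction A rule: finite_induct)
  case (insert i A)
  define P Q M N where "P = prod a A" and "Q = prod b A"
    and "M = (\<Prod>i\<in>A. \<bar>b i\<bar> + \<bar>a i - b i\<bar>)" and "N = (\<Prod>i\<in>A. \<bar>b i\<bar>)"
  have IH: "\<bar>P - Q\<bar> \<le> M - N" using insert.IH by (simp add: P_def Q_def M_def N_def)
  have PM: "\<bar>P\<bar> \<le> M" unfolding P_def M_def abs_prod by (intro prod_mono) auto
  have "a i * P - b i * Q = (a i - b i) * P + b i * (P - Q)" by (simp add: algebra_simps)
  then have "\<bar>a i * P - b i * Q\<bar> \<le> \<bar>a i - b i\<bar> * \<bar>P\<bar> + \<bar>b i\<bar> * \<bar>P - Q\<bar>"
    by (metis abs_mult abs_triangle_ineq)
  also have "\<dots> \<le> \<bar>a i - b i\<bar> * M + \<bar>b i\<bar> * (M - N)"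
    using IH PM by (intro add_mono mult_left_mono) auto
  finally show ?case
    using insert.hyps by (simp add: algebra_simps P_def Q_def M_def N_def)
qed auto

lemma fact_add_le: "fact (a + b) \<le> (2 ^ (a + b) * fact a * fact b :: real)"
proof -
  have "real ((a + b) choose a) \<le> 2 ^ (a + b)"
    using binomial_le_pow2[of "a + b" a] by (metis of_nat_le_iff of_nat_numeral of_nat_power)
  moreover have "fact (a + b) = (fact a * fact b * real ((a + b) choose a) :: real)"
    by (simp add: binomial_fact)
  ultimately show ?thesis
    by (simp add: mult_left_mono mult.commute mult.left_commute)
qed

text \<open>The multinomial coefficient is at most \<open>card A ^ sum v A\<close>. In the induction
  the new binomial coefficient, times \<open>a ^ s\<close>, is one term of the expansion of
  \<open>(1 + a) ^ (v x + s)\<close>.\<close>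

lemma fact_sum_le:
  assumes "finite A"
  shows "fact (sum v A) \<le> (real (card A) ^ sum v A * (\<Prod>i\<in>A. fact (v i)) :: real)"
proof (cases "A = {}")
  case False
  with assms show ?thesis
  proof (induction A rule: finite_ne_induct)
    case (singleton x)
    then show ?case by simp
  next
    case (insert x A)
    define s a where "s = sum v A" and "a = card A"
    have a: "a \<ge> 1" using insert by (simp add: a_def Suc_le_eq card_gt_0_iff)
    have "real ((v x + s) choose v x) * real a ^ s \<le> (\<Sum>k\<le>v x + s. real ((v x + s) choose k) * 1 ^ k * real a ^ (v x + s - k))"
      by (rule order_trans[OF _ member_le_sum[of "v x"]]) auto
    also have "\<dots> = (1 + real a) ^ (v x + s)" by (rule binomial_ring[symmetric])
    finally have *: "real ((v x + s) choose v x) * real a ^ s \<le> (1 + real a) ^ (v x + s)" .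
    have "fact (v x + s) = (fact (v x) * real ((v x + s) choose v x) * fact s :: real)"
      by (simp add: binomial_fact)
    also have "\<dots> \<le> fact (v x) * real ((v x + s) choose v x) * (real a ^ s * (\<Prod>i\<in>A. fact (v i)))"
      using insert.IH by (intro mult_left_mono) (auto simp: s_def a_def)
    also have "\<dots> \<le> fact (v x) * (\<Prod>i\<in>A. fact (v i)) * (1 + real a) ^ (v x + s)"
      using mult_left_mono[OF *, of "fact (v x) * (\<Prod>i\<in>A. fact (v i))"]
      by (simp add: mult_ac prod_nonneg)
    finally show ?case using insert.hyps by (simp add: s_def a_def mult_ac)
  qed
qed simp

text \<open>The share of one variable with exponent \<open>l\<close> in the cost of absorbing a
  monomial in \<open>N\<close> variables. The power of \<open>N\<close> pays for the multinomial
  coefficient that arises when the factorial of the half degree is split among the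
  variables.\<close>

definition weight :: "nat \<Rightarrow> nat \<Rightarrow> real" where
  "weight N l = real N ^ ((l + 1) div 2) * fact ((l + 1) div 2)"

lemma weight_nonneg: "weight N l \<ge> 0"
  by (simp add: weight_def)

lemma fact_sum_le_prod_weight:
  fixes a :: "'n::finite \<Rightarrow> nat"
  shows "fact (\<Sum>i\<in>UNIV. (a i + 1) div 2) \<le> (\<Prod>i\<in>UNIV. weight CARD('n) (a i))"
  using fact_sum_le[of "UNIV :: 'n set" "\<lambda>i. (a i + 1) div 2"]
  by (simp add: weight_def prod.distrib power_sum)

text \<open>The passage from one variable to many: if each \<open>Var i ^ g i\<close> is
  approximated within \<open>h\<close> in the weighted norm, the product of the approximations
  replaces the monomial at a cost tending to 0 with \<open>h\<close>. Both products are expanded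
  over exponent functions \<open>\<phi>\<close>; since the weights are multiplicative, the sum of
  the coefficient errors factors back into one sum per variable.\<close>

lemma absorbed_prod_diff:
  fixes u e :: "'n::finite \<Rightarrow> nat \<Rightarrow> real" and g :: "'n \<Rightarrow> nat"
  defines "K \<equiv> fact CARD('n)" and "w \<equiv> weight CARD('n)"
  assumes g: "\<And>i. g i \<le> L"
    and u: "\<And>i. (\<Sum>l\<le>L. w l * \<bar>u i l - of_bool (l = g i)\<bar>) \<le> h"
  shows "absorbed (\<bar>c\<bar> * (K * ((\<Prod>i\<in>UNIV. w (g i) + h) - (\<Prod>i\<in>UNIV. w (g i)))))
    (Const c * ((\<Prod>i\<in>UNIV. Var i ^ g i) - (\<Prod>i\<in>UNIV. \<Sum>l\<le>L. Const (u i l) * Var i ^ l)) :: 'n rpoly)"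
proof -
  define F where "F = (PiE UNIV (\<lambda>_. {..L}) :: ('n \<Rightarrow> nat) set)"
  \<comment> \<open>The coefficients of \<open>Var i ^ g i\<close>, so that the monomial expands in
    the same form as its approximation.\<close>
  define dl where "dl i l = (of_bool (l = g i) :: real)" for i :: 'n and l
  have w0: "w l \<ge> 0" for l by (simp add: w_def weight_nonneg)
  have exp: "(\<Prod>i\<in>UNIV. \<Sum>l\<le>L. Const (v i l) * Var i ^ l)
    = (\<Sum>\<phi>\<in>F. Const (\<Prod>i\<in>UNIV. v i (\<phi> i)) * (\<Prod>i\<in>UNIV. Var i ^ \<phi> i) :: 'n rpoly)" for v
    unfolding F_def by (subst prod_sum_PiE) (auto simp: prod.distrib Const_prod)
  have "(\<Sum>l\<le>L. Const (dl i l) * Var i ^ l) = (Var i ^ g i :: 'n rpoly)" for i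
  proof -
    have "(\<Sum>l\<le>L. Const (dl i l) * Var i ^ l) = (\<Sum>l\<le>L. if l = g i then (Var i ^ l :: 'n rpoly) else 0)"
      by (intro sum.cong) (auto simp: dl_def)
    then show ?thesis using g[of i] by simp
  qed
  then have mon: "(\<Prod>i\<in>UNIV. Var i ^ g i) = (\<Sum>\<phi>\<in>F. Const (\<Prod>i\<in>UNIV. dl i (\<phi> i)) * (\<Prod>i\<in>UNIV. Var i ^ \<phi> i) :: 'n rpoly)"
    using exp[of dl] by simp
  define C where "C \<phi> = (\<Prod>i\<in>UNIV. dl i (\<phi> i)) - (\<Prod>i\<in>UNIV. u i (\<phi> i))" for \<phi>
  have eq: "Const c * ((\<Prod>i\<in>UNIV. Var i ^ g i) - (\<Prod>i\<in>UNIV. \<Sum>l\<le>L. Const (u i l) * Var i ^ l))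
    = (\<Sum>\<phi>\<in>F. Const (c * C \<phi>) * (\<Prod>i\<in>UNIV. Var i ^ \<phi> i) :: 'n rpoly)"
    unfolding mon exp C_def
    by (simp add: sum_subtractf[symmetric] sum_distrib_left Const_mult Const_diff left_diff_distrib mult.assoc)
  have "absorbed (\<Sum>\<phi>\<in>F. \<bar>c\<bar> * (K * ((\<Prod>i\<in>UNIV. w (\<phi> i)) * \<bar>C \<phi>\<bar>)))
      (\<Sum>\<phi>\<in>F. Const (c * C \<phi>) * (\<Prod>i\<in>UNIV. Var i ^ \<phi> i) :: 'n rpoly)"
  proof (intro absorbed_sum absorbed_monomial)
    fix \<phi> :: "'n \<Rightarrow> nat"
    show "fact CARD('n) * fact (\<Sum>i\<in>UNIV. (\<phi> i + 1) div 2) * \<bar>c * C \<phi>\<bar>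
      \<le> \<bar>c\<bar> * (K * ((\<Prod>i\<in>UNIV. w (\<phi> i)) * \<bar>C \<phi>\<bar>))"
      using mult_right_mono[OF fact_sum_le_prod_weight[of \<phi>], of "K * \<bar>c * C \<phi>\<bar>"]
      by (simp add: K_def w_def abs_mult mult_ac)
  qed
  moreover have "(\<Sum>\<phi>\<in>F. \<bar>c\<bar> * (K * ((\<Prod>i\<in>UNIV. w (\<phi> i)) * \<bar>C \<phi>\<bar>)))
    \<le> \<bar>c\<bar> * (K * ((\<Prod>i\<in>UNIV. w (g i) + h) - (\<Prod>i\<in>UNIV. w (g i))))"
  proof -
    have "(\<Sum>\<phi>\<in>F. (\<Prod>i\<in>UNIV. w (\<phi> i)) * \<bar>C \<phi>\<bar>)
      \<le> (\<Sum>\<phi>\<in>F. (\<Prod>i\<in>UNIV. w (\<phi> i) * (dl i (\<phi> i) + \<bar>u i (\<phi> i) - dl i (\<phi> i)\<bar>))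
              - (\<Prod>i\<in>UNIV. w (\<phi> i) * dl i (\<phi> i)))"
    proof (rule sum_mono)
      fix \<phi> :: "'n \<Rightarrow> nat"
      have "\<bar>C \<phi>\<bar> \<le> (\<Prod>i\<in>UNIV. dl i (\<phi> i) + \<bar>u i (\<phi> i) - dl i (\<phi> i)\<bar>) - (\<Prod>i\<in>UNIV. dl i (\<phi> i))"
        using abs_prod_diff_le[of UNIV "\<lambda>i. u i (\<phi> i)" "\<lambda>i. dl i (\<phi> i)"]
        by (simp add: C_def dl_def abs_minus_commute)
      from mult_left_mono[OF this prod_nonneg[of UNIV "\<lambda>i. w (\<phi> i)"]]
      show "(\<Prod>i\<in>UNIV. w (\<phi> i)) * \<bar>C \<phi>\<bar>
        \<le> (\<Prod>i\<in>UNIV. w (\<phi> i) * (dl i (\<phi> i) + \<bar>u i (\<phi> i) - dl i (\<phi> i)\<bar>))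
              - (\<Prod>i\<in>UNIV. w (\<phi> i) * dl i (\<phi> i))"
        using w0 by (simp add: prod.distrib right_diff_distrib)
    qed
    also have "\<dots> = (\<Prod>i\<in>UNIV. \<Sum>l\<le>L. w l * (dl i l + \<bar>u i l - dl i l\<bar>))
        - (\<Prod>i\<in>UNIV. \<Sum>l\<le>L. w l * dl i l)"
      unfolding F_def by (subst (1 2) prod_sum_PiE) (auto simp: sum_subtractf)
    also have "(\<lambda>i. \<Sum>l\<le>L. w l * dl i l) = (\<lambda>i. w (g i))"
      using g by (simp add: dl_def of_bool_def if_distrib cong: if_cong)
    also have "(\<Prod>i\<in>UNIV. \<Sum>l\<le>L. w l * (dl i l + \<bar>u i l - dl i l\<bar>)) \<le> (\<Prod>i\<in>UNIV. w (g i) + h)"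
    proof (rule prod_mono, intro conjI)
      fix i
      show "0 \<le> (\<Sum>l\<le>L. w l * (dl i l + \<bar>u i l - dl i l\<bar>))"
        by (intro sum_nonneg mult_nonneg_nonneg w0) (auto simp: dl_def)
      have "(\<Sum>l\<le>L. w l * dl i l) = w (g i)"
        using g by (simp add: dl_def of_bool_def if_distrib cong: if_cong)
      then show "(\<Sum>l\<le>L. w l * (dl i l + \<bar>u i l - dl i l\<bar>)) \<le> w (g i) + h"
        using u[of i] by (simp add: distrib_left sum.distrib dl_def)
    qed
    finally have "(\<Sum>\<phi>\<in>F. (\<Prod>i\<in>UNIV. w (\<phi> i)) * \<bar>C \<phi>\<bar>)
      \<le> (\<Prod>i\<in>UNIV. w (g i) + h) - (\<Prod>i\<in>UNIV. w (g i))" by simp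
    then show ?thesis
      unfolding sum_distrib_left[symmetric] by (intro mult_left_mono) (auto simp: K_def)
  qed
  ultimately show ?thesis unfolding eq by (rule absorbed_mono)
qed

section \<open>The concentrating kernel\<close>

definition csinc :: "complex \<Rightarrow> complex" where
  "csinc z = (if z = 0 then 1 else sin z / z)"

definition rsinc :: "real \<Rightarrow> real" where
  "rsinc u = (if u = 0 then 1 else sin u / u)"

lemma csinc_of_real: "csinc (of_real u) = of_real (rsinc u)"
  by (simp add: csinc_def rsinc_def sin_of_real)

text \<open>The singularity of \<open>sin z / z\<close> at 0 is removable: the limit there is the
  derivative of \<open>sin\<close> at 0, namely 1.\<close>

lemma csinc_holomorphic: "csinc holomorphic_on UNIV"
proof (rule no_isolated_singularity)
  have hol: "(\<lambda>z. sin z / z) holomorphic_on UNIV - {0 :: complex}"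
    by (intro holomorphic_intros) auto
  show hol': "csinc holomorphic_on UNIV - {0}"
    using hol by (rule holomorphic_transform) (auto simp: csinc_def)
  have "((\<lambda>z::complex. sin z / z) \<longlongrightarrow> 1) (at 0)"
    using DERIV_sin[of "0::complex"] by (simp add: DERIV_def)
  then have "(csinc \<longlongrightarrow> 1) (at 0)"
    by (rule Lim_transform_eventually) (auto simp: csinc_def eventually_at_filter)
  then have "isCont csinc 0" by (simp add: isCont_def csinc_def)
  moreover have "isCont csinc z" if "z \<noteq> 0" for z
    using holomorphic_on_imp_continuous_on[OF hol'] that
    by (simp add: continuous_on_eq_continuous_at open_delete)
  ultimately show "continuous_on UNIV csinc"
    by (intro continuous_at_imp_continuous_on ballI) metis
qed auto

lemma norm_csinc_le: "norm (csinc z) \<le> exp (norm z)"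
proof (cases "z = 0")
  case False
  have "norm (sin z - sin 0) \<le> exp (norm z) * norm (z - 0)"
  proof (rule field_differentiable_bound[where S = "cball 0 (norm z)" and f' = cos])
    fix w :: complex assume "w \<in> cball 0 (norm z)"
    then show "norm (cos w) \<le> exp (norm z)"
      using norm_cos_le[of w] by (smt (verit) dist_0_norm exp_le_cancel_iff mem_cball)
  qed (auto intro!: derivative_eq_intros)
  then show ?thesis using False by (simp add: csinc_def norm_divide field_simps)
qed (simp add: csinc_def)

text \<open>The second bound supplies the factor \<open>1 / W^2\<close> in the estimate of the
  higher moments.\<close>

lemma rsinc_le: "\<bar>rsinc u\<bar> \<le> 1" "\<bar>u * rsinc u\<bar> \<le> 1"
  using abs_sin_x_le_abs_x[of u] by (auto simp: rsinc_def divide_le_eq)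

lemma rsinc_ge_half: "\<exists>d>0. d \<le> 1 \<and> (\<forall>u. \<bar>u\<bar> \<le> d \<longrightarrow> rsinc u \<ge> 1/2)"
proof -
  have "((\<lambda>u::real. sin u / u) \<longlongrightarrow> 1) (at 0)"
    using DERIV_sin[of "0::real"] by (simp add: DERIV_def)
  then have "eventually (\<lambda>u::real. sin u / u > 1/2) (at 0)"
    by (rule order_tendstoD) simp
  then obtain e where e: "e > 0" "\<And>u::real. u \<noteq> 0 \<Longrightarrow> \<bar>u\<bar> < e \<Longrightarrow> sin u / u > 1/2"
    by (auto simp: eventually_at)
  show ?thesis
  proof (intro exI[of _ "min 1 (e/2)"] conjI allI impI)
    fix u :: real assume "\<bar>u\<bar> \<le> min 1 (e/2)"
    then show "rsinc u \<ge> 1/2"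
      using e(1) e(2)[of u] by (cases "u = 0") (auto simp: rsinc_def intro: less_imp_le)
  qed (use e in auto)
qed

text \<open>The Gaussian, of order 2, is what competes with the factorial weights, so
  \<open>c\<close> has to be small and is later fixed by the number of variables. The other factor
  grows only exponentially, so \<open>W\<close> can be enlarged freely to concentrate the kernel at
  0.\<close>

definition kern :: "real \<Rightarrow> real \<Rightarrow> complex \<Rightarrow> complex" where
  "kern c W z = exp (- of_real (c / 2) * z ^ 2) * csinc (of_real W * z)"

definition rkern :: "real \<Rightarrow> real \<Rightarrow> real \<Rightarrow> real" where
  "rkern c W u = exp (- (c / 2) * u ^ 2) * rsinc (W * u)"

text \<open>Coefficient of \<open>x ^ i\<close> in \<open>rkern c W (x - y)\<close>.\<close>

definition kern_coeff :: "real \<Rightarrow> real \<Rightarrow> nat \<Rightarrow> real \<Rightarrow> real" where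
  "kern_coeff c W i y = Re ((deriv ^^ i) (kern c W) (- of_real y)) / fact i"

lemma kern_of_real: "kern c W (of_real u) = of_real (rkern c W u)"
proof -
  have "exp (- of_real (c / 2) * (of_real u) ^ 2 :: complex) = of_real (exp (- (c / 2) * u ^ 2))"
    by (simp flip: exp_of_real)
  then show ?thesis
    using csinc_of_real[of "W * u"] by (simp add: kern_def rkern_def)
qed

lemma kern_holomorphic: "kern c W holomorphic_on S"
proof -
  have "(csinc \<circ> (\<lambda>z. of_real W * z)) holomorphic_on UNIV"
    by (rule holomorphic_on_compose_gen[OF _ csinc_holomorphic]) (auto intro!: holomorphic_intros)
  then have "kern c W holomorphic_on UNIV"
    unfolding kern_def[abs_def] o_def by (intro holomorphic_intros)
  then show ?thesis by (rule holomorphic_on_subset) auto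
qed

lemma continuous_kern_coeff: "continuous_on UNIV (kern_coeff c W i)"
proof -
  have "(deriv ^^ i) (kern c W) holomorphic_on UNIV"
    by (rule holomorphic_higher_deriv[OF kern_holomorphic]) simp
  then have "continuous_on UNIV ((deriv ^^ i) (kern c W))"
    by (rule holomorphic_on_imp_continuous_on)
  then have "continuous_on UNIV ((deriv ^^ i) (kern c W) \<circ> (\<lambda>y. - of_real y))"
    by (intro continuous_on_compose continuous_intros) (auto intro: continuous_on_subset)
  then show ?thesis
    unfolding kern_coeff_def o_def by (intro continuous_intros) auto
qed

lemma kern_coeff_sums: "(\<lambda>i. kern_coeff c W i y * x ^ i) sums rkern c W (x - y)"
proof -
  have "(\<lambda>i. (deriv ^^ i) (kern c W) (- of_real y) / fact i * (of_real (x - y) - (- of_real y)) ^ i)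
      sums kern c W (of_real (x - y))"
  proof (rule holomorphic_power_series[where r = "\<bar>x\<bar> + 1"])
    have "- complex_of_real y - of_real (x - y) = of_real (- x)" by simp
    then have "dist (- complex_of_real y) (of_real (x - y)) = \<bar>x\<bar>"
      unfolding dist_norm by (metis abs_minus_cancel norm_of_real)
    then show "complex_of_real (x - y) \<in> ball (- of_real y) (\<bar>x\<bar> + 1)" by simp
  qed (rule kern_holomorphic)
  then have "(\<lambda>i. Re ((deriv ^^ i) (kern c W) (- of_real y) / fact i * (of_real x) ^ i))
      sums Re (kern c W (of_real (x - y)))"
    by (intro sums_Re) simp
  moreover have "Re (z / fact i * (of_real x) ^ i) = Re z / fact i * x ^ i" for z i
  proof -
    have "z / fact i * (of_real x) ^ i = of_real (x ^ i / fact i) * z" by simp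
    then have "Re (z / fact i * (of_real x) ^ i) = Re (of_real (x ^ i / fact i) * z)" by (simp only:)
    also have "\<dots> = x ^ i / fact i * Re z"
      by (simp only: times_complex.sel Re_complex_of_real Im_complex_of_real mult_zero_left diff_zero)
    finally show ?thesis by simp
  qed
  ultimately show ?thesis by (simp add: kern_coeff_def kern_of_real del: of_real_diff)
qed

text \<open>Control on the circle of radius \<open>r\<close> about \<open>- y\<close>, for use in
  Cauchy's inequality. Gaussian decay in \<open>y\<close> is retained so that the later integrals
  over \<open>y\<close> converge.\<close>

lemma norm_kern_le:
  assumes c: "c > 0" and W: "W \<ge> 0" and w: "norm w = r"
  shows "norm (kern c W (- of_real y + w))
    \<le> exp (- (c/8) * y^2) * exp (3/2 * c * r^2 + W * r + 2 * W^2 / c)"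
proof -
  define a b where "a = Re w" and "b = Im w"
  have r: "r^2 = a^2 + b^2" "r \<ge> 0" using w cmod_power2[of w] by (auto simp: a_def b_def)
  have "y * a \<le> \<bar>y\<bar> * \<bar>a\<bar>" by (simp flip: abs_mult)
  also have "\<dots> \<le> \<bar>y\<bar> * r"
    using w abs_Re_le_cmod[of w] by (intro mult_left_mono) (auto simp: a_def)
  finally have ay: "y * a \<le> \<bar>y\<bar> * r" .
  have "Re (- of_real (c / 2) * (- of_real y + w)^2) = - (c/2) * (y^2 - 2 * (y * a) + a^2 - b^2)"
  proof -
    have "Re ((- of_real y + w)^2) = y^2 - 2 * (y * a) + a^2 - b^2"
      by (simp add: a_def b_def power2_eq_square algebra_simps)
    then show ?thesis by simp
  qed
  also have "\<dots> \<le> - (c/2) * (y^2 - 2 * (\<bar>y\<bar> * r) - r^2)"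
  proof -
    have "y^2 - 2 * (\<bar>y\<bar> * r) - r^2 \<le> y^2 - 2 * (y * a) + a^2 - b^2"
      unfolding r(1) using ay zero_le_power2[of a] by linarith
    then show ?thesis using c by (simp add: mult_left_mono)
  qed
  finally have "norm (exp (- of_real (c / 2) * (- of_real y + w)^2)) \<le> exp (- (c/2) * (y^2 - 2 * (\<bar>y\<bar> * r) - r^2))"
    by (simp add: norm_exp_eq_Re)
  moreover have "norm (csinc (of_real W * (- of_real y + w))) \<le> exp (W * (\<bar>y\<bar> + r))"
  proof -
    have "norm (of_real W * (- of_real y + w)) \<le> W * (\<bar>y\<bar> + r)"
      unfolding norm_mult using W w norm_triangle_ineq[of "- of_real y" w]
      by (simp add: mult_left_mono)
    then show ?thesis by (intro order_trans[OF norm_csinc_le]) simp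
  qed
  ultimately have "norm (kern c W (- of_real y + w))
    \<le> exp (- (c/2) * (y^2 - 2 * (\<bar>y\<bar> * r) - r^2)) * exp (W * (\<bar>y\<bar> + r))"
    unfolding kern_def norm_mult by (intro mult_mono) auto
  also have "\<dots> \<le> exp (- (c/8) * y^2) * exp (3/2 * c * r^2 + W * r + 2 * W^2 / c)"
  proof -
    \<comment> \<open>Of the available \<open>c/2 * y^2\<close>, the term
      \<open>c * (\<bar>y\<bar> * r)\<close> consumes \<open>c/4 * y^2\<close> and
      \<open>W * \<bar>y\<bar>\<close> consumes \<open>c/8 * y^2\<close>; the remaining
      \<open>c/8 * y^2\<close> is the decay that is kept.\<close>
    have 1: "c * (\<bar>y\<bar> * r) \<le> c * (r^2 + y^2 / 4)"
    proof -
      have "0 \<le> (\<bar>y\<bar> / 2 - r)^2" by simp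
      then have "\<bar>y\<bar> * r \<le> r^2 + y^2 / 4" by (simp add: power2_eq_square algebra_simps)
      then show ?thesis using c by (intro mult_left_mono) auto
    qed
    have 2: "W * \<bar>y\<bar> \<le> c/8 * y^2 + 2 * W^2 / c"
    proof -
      have "0 \<le> (c * \<bar>y\<bar> - 4 * W)^2" by simp
      then have "8 * c * (W * \<bar>y\<bar>) \<le> c^2 * y^2 + 16 * W^2" by (simp add: power2_eq_square algebra_simps)
      then show ?thesis using c by (simp add: field_simps power2_eq_square)
    qed
    show ?thesis
      unfolding exp_add[symmetric] using 1 2 by (simp add: algebra_simps)
  qed
  finally show ?thesis .
qed

text \<open>Cauchy's inequality on the circle of radius \<open>r\<close> about \<open>- y\<close>.
  The radius stays free, since the suitable choice depends on \<open>i\<close>.\<close>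

lemma kern_coeff_bound:
  assumes "c > 0" "W \<ge> 0" "r > 0"
  shows "\<bar>kern_coeff c W i y\<bar>
    \<le> exp (3/2 * c * r^2 + W * r + 2 * W^2 / c) / r ^ i * exp (- (c/8) * y^2)"
proof -
  have "norm ((deriv ^^ i) (kern c W) (- of_real y))
    \<le> fact i * (exp (- (c/8) * y^2) * exp (3/2 * c * r^2 + W * r + 2 * W^2 / c)) / r ^ i"
  proof (rule Cauchy_inequality)
    fix z :: complex assume "norm (- of_real y - z) = r"
    then have "norm (z + of_real y) = r" by (metis diff_minus_eq_add norm_minus_commute)
    from norm_kern_le[OF assms(1,2) this, of y]
    show "norm (kern c W z) \<le> exp (- (c/8) * y^2) * exp (3/2 * c * r^2 + W * r + 2 * W^2 / c)"
      by simp
  next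
    show "kern c W holomorphic_on ball (- of_real y) r" by (rule kern_holomorphic)
    show "continuous_on (cball (- of_real y) r) (kern c W)"
      by (rule holomorphic_on_imp_continuous_on) (rule kern_holomorphic)
    show "0 < r" by (rule assms)
  qed
  then have "\<bar>Re ((deriv ^^ i) (kern c W) (- of_real y))\<bar>
    \<le> fact i * (exp (- (c/8) * y^2) * exp (3/2 * c * r^2 + W * r + 2 * W^2 / c)) / r ^ i"
    by (rule order_trans[OF abs_Re_le_cmod])
  from divide_right_mono[OF this, of "fact i"] show ?thesis
    by (simp add: kern_coeff_def mult.commute)
qed

section \<open>Weighted decay of the Taylor coefficients\<close>

lemma weight_ge_1: "N \<ge> 1 \<Longrightarrow> weight N l \<ge> 1"
  using mult_mono[of 1 "real N ^ ((l + 1) div 2)" 1 "fact ((l + 1) div 2) :: real"]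
  by (simp add: weight_def)

text \<open>Halving with rounding up is subadditive, and the factor \<open>2 ^ (a + b)\<close> from
  splitting the factorial is absorbed by doubling \<open>N\<close>. This is why the kernel
  coefficients are measured with \<open>weight (2 * N)\<close> and the coefficients of the square
  with \<open>weight N\<close>.\<close>

lemma weight_add_le:
  assumes "N \<ge> 1"
  shows "weight N (i + j) \<le> weight (2 * N) i * weight (2 * N) j"
proof -
  define a b t where "a = (i + 1) div 2" and "b = (j + 1) div 2" and "t = (i + j + 1) div 2"
  have t: "t \<le> a + b" by (simp add: a_def b_def t_def)
  have "weight N (i + j) = real N ^ t * fact t" by (simp add: weight_def t_def)
  also have "\<dots> \<le> real N ^ (a + b) * fact (a + b)"
    using t assms by (intro mult_mono power_increasing fact_mono) auto
  also have "\<dots> \<le> real N ^ (a + b) * (2 ^ (a + b) * fact a * fact b)"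
    by (intro mult_left_mono fact_add_le) auto
  also have "\<dots> = weight (2 * N) i * weight (2 * N) j"
    by (simp add: weight_def a_def b_def power_add power_mult_distrib)
  finally show ?thesis .
qed

text \<open>The Cauchy product has \<open>l + 1\<close> terms, and splitting the weight between the
  two factors bounds each by \<open>D^2 * q ^ l\<close>.\<close>

lemma sq_coeff_bound:
  assumes N: "N \<ge> 1" and s: "\<And>k. weight (2 * N) k * \<bar>s k\<bar> \<le> D * q ^ k" and "D \<ge> 0" "q \<ge> 0"
  shows "weight N l * \<bar>sq_coeff s l\<bar> \<le> D^2 * (real (l + 1) * q ^ l)"
proof -
  have "weight N l * \<bar>sq_coeff s l\<bar> \<le> weight N l * (\<Sum>k\<le>l. \<bar>s k * s (l - k)\<bar>)"
    unfolding sq_coeff_def by (intro mult_left_mono weight_nonneg sum_abs)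
  also have "\<dots> = (\<Sum>k\<le>l. weight N l * (\<bar>s k\<bar> * \<bar>s (l - k)\<bar>))"
    by (simp add: sum_distrib_left abs_mult)
  also have "\<dots> \<le> (\<Sum>k\<le>l. D^2 * q ^ l)"
  proof (rule sum_mono)
    fix k assume k: "k \<in> {..l}"
    have "weight N l * (\<bar>s k\<bar> * \<bar>s (l - k)\<bar>) \<le> weight (2 * N) k * weight (2 * N) (l - k) * (\<bar>s k\<bar> * \<bar>s (l - k)\<bar>)"
      using weight_add_le[OF N, of k "l - k"] k by (intro mult_right_mono) auto
    also have "\<dots> = (weight (2 * N) k * \<bar>s k\<bar>) * (weight (2 * N) (l - k) * \<bar>s (l - k)\<bar>)"
      by (simp add: mult_ac)
    also have "\<dots> \<le> (D * q ^ k) * (D * q ^ (l - k))"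
      by (rule mult_mono[OF s s]) (use assms(3,4) in \<open>auto intro!: mult_nonneg_nonneg weight_nonneg\<close>)
    also have "\<dots> = D^2 * q ^ l"
      using k by (simp add: power2_eq_square mult_ac flip: power_add)
    finally show "weight N l * (\<bar>s k\<bar> * \<bar>s (l - k)\<bar>) \<le> D^2 * q ^ l" .
  qed
  finally show ?thesis by (simp add: algebra_simps)
qed

lemma integrable_power_gaussian:
  assumes "a > 0"
  shows "integrable lborel (\<lambda>y::real. \<bar>y\<bar> ^ b * exp (- a * y^2))"
proof -
  \<comment> \<open>The standard deviation for which the centred normal density is a multiple of
    \<open>exp (- a * y^2)\<close>.\<close>
  define \<sigma> where "\<sigma> = sqrt (1 / (2 * a))"
  have \<sigma>: "\<sigma> > 0" "\<sigma>^2 = 1 / (2 * a)" using assms by (simp_all add: \<sigma>_def)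
  have "integrable lborel (\<lambda>y. sqrt (2 * pi * \<sigma>^2) * (normal_density 0 \<sigma> y * \<bar>y - 0\<bar> ^ b))"
    using integrable_normal_moment_abs[OF \<sigma>(1), of 0 b] by (rule integrable_mult_right)
  moreover have "sqrt (2 * pi * \<sigma>^2) * (normal_density 0 \<sigma> y * \<bar>y - 0\<bar> ^ b) = \<bar>y\<bar> ^ b * exp (- a * y^2)" for y
  proof -
    have "2 * pi * \<sigma>^2 > 0" using \<sigma>(1) by auto
    then have "sqrt (2 * pi * \<sigma>^2) \<noteq> 0" by (metis real_sqrt_gt_zero less_irrefl)
    then show ?thesis unfolding normal_density_def using assms by (simp add: \<sigma>(2) field_simps)
  qed
  ultimately show ?thesis by (simp only:)
qed

lemma powser_unique:
  fixes a b :: "nat \<Rightarrow> real"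
  assumes a: "\<And>x. \<bar>x\<bar> < 1 \<Longrightarrow> (\<lambda>n. a n * x ^ n) sums f x"
    and b: "\<And>x. \<bar>x\<bar> < 1 \<Longrightarrow> (\<lambda>n. b n * x ^ n) sums f x"
  shows "a n = b n"
proof (rule ccontr)
  assume n: "a n \<noteq> b n"
  have sm: "(\<lambda>n. (a n - b n) * (x - 0) ^ n) sums 0" if "norm (x - 0) < 1" for x
    using sums_diff[OF a b, of x x] that by (simp add: left_diff_distrib)
  \<comment> \<open>Index 0 is compared separately, since the isolation of zeros in
    \<open>powser_0_nonzero\<close> is applied at a positive index.\<close>
  have "(\<lambda>n. (a n - b n) * 0 ^ n) sums (a 0 - b 0)"
    using powser_sums_zero[of "\<lambda>n. a n - b n"] by simp
  with sm[of 0] have "a 0 = b 0" using sums_unique2 by fastforce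
  with n have "n > 0" by (cases n) auto
  show False
  proof (rule powser_0_nonzero[of 1 0 "\<lambda>n. a n - b n" "\<lambda>_. 0" n])
    fix s :: real assume "0 < s" and z: "\<And>z::real. z \<in> cball 0 s - {0} \<Longrightarrow> (0::real) \<noteq> 0"
    then show False using z[of s] by auto
  qed (use sm n \<open>n > 0\<close> in auto)
qed

text \<open>The width for which the Gaussian growth \<open>3/2 * c * r\<^sup>2\<close> in \<open>kern_coeff_bound\<close> is exactly \<open>t\<close> on the
  Cauchy circle of radius \<open>r = sqrt (2 * N * exp 2 * t)\<close> used for the coefficients \<open>i\<close> with
  \<open>t = (i + 1) div 2\<close>.\<close>

definition kern_width :: "nat \<Rightarrow> real" where
  "kern_width N = 1 / (3 * real N * exp 2)"

text \<open>On the circle of radius \<open>r = \<rho> * sqrt t\<close>, the power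
  \<open>r ^ (2 * t)\<close> exceeds the weight by a factor of at least \<open>exp (2 * t)\<close>,
  of which the Gaussian growth uses up \<open>exp t\<close>. The other losses are exponential in
  \<open>r\<close>, hence in \<open>sqrt t\<close>, and cost at most \<open>exp (t / 2)\<close> up
  to a constant. This leaves \<open>exp (- t / 2)\<close>, which is at most
  \<open>exp (- i / 4)\<close>.\<close>

lemma kern_coeff_weight_bound:
  assumes N: "N \<ge> 1" and W: "W \<ge> 0"
  defines "c \<equiv> kern_width N"
  shows "\<exists>D\<ge>0. \<forall>i y. weight (2 * N) i * \<bar>kern_coeff c W i y\<bar> \<le> D * exp (- 1/4) ^ i * exp (- (c/8) * y^2)"
proof -
  have c: "c > 0" using N by (simp add: c_def kern_width_def)
  define \<rho> where "\<rho> = sqrt (2 * real N * exp 2)"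
  have \<rho>2: "\<rho>^2 = 2 * real N * exp 2" by (simp add: \<rho>_def)
  have "2 * real N * exp 2 \<ge> 2 * 1 * 1" using N by (intro mult_mono) auto
  then have \<rho>: "\<rho> \<ge> 1" by (simp add: \<rho>_def)
  have c\<rho>: "3/2 * c * \<rho>^2 = 1" using N unfolding \<rho>2 by (simp add: c_def kern_width_def)
  define C where "C = 2 * W^2 / c"
  \<comment> \<open>\<open>D\<close> serves both cases below: \<open>3/2 * c + W\<close> comes from
    radius 1 at \<open>i = 0\<close>, and \<open>(W + 1)^2 * \<rho>^2 / 2\<close> from completing a
    square at \<open>i > 0\<close>.\<close>
  define D where "D = exp (C + (W + 1)^2 * \<rho>^2 / 2 + 3/2 * c + W)"
  have C: "C \<ge> 0" using c by (simp add: C_def)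
  have "weight (2 * N) i * \<bar>kern_coeff c W i y\<bar> \<le> D * exp (- 1/4) ^ i * exp (- (c/8) * y^2)" for i y
  proof (cases "i = 0")
    \<comment> \<open>Here \<open>t\<close> would be 0 and the circle degenerate, so radius 1 is
      used instead.\<close>
    case True
    have "\<bar>kern_coeff c W 0 y\<bar> \<le> exp (3/2 * c + W + C) * exp (- (c/8) * y^2)"
      using kern_coeff_bound[OF c W, of 1 0 y] by (simp add: C_def)
    also have "\<dots> \<le> D * exp (- (c/8) * y^2)"
      unfolding D_def by (intro mult_right_mono) (simp_all)
    finally show ?thesis using True by (simp add: weight_def)
  next
    case False
    define t where "t = (i + 1) div 2"
    have t: "t \<ge> 1" "i + 1 \<ge> 2 * t" "real i \<le> 2 * real t" using False by (auto simp: t_def)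
    define r where "r = \<rho> * sqrt (real t)"
    have r2: "r^2 = \<rho>^2 * real t" by (simp add: r_def power_mult_distrib)
    have "1 * 1 \<le> r" unfolding r_def using \<rho> t by (intro mult_mono) auto
    then have r: "r \<ge> 1" by simp
    have r2t: "r ^ (2 * t) = real (2 * N) ^ t * exp (2 * real t) * real t ^ t"
      by (simp add: power_mult r2 \<rho>2 power_mult_distrib exp_of_nat2_mult[symmetric] flip: exp_of_nat_mult)
    have "weight (2 * N) i * exp (2 * real t) \<le> r ^ (2 * t)"
    proof -
      have "fact t \<le> real t ^ t" by (metis fact_le_power of_nat_power)
      then have "real (2 * N) ^ t * fact t * exp (2 * real t) \<le> real (2 * N) ^ t * real t ^ t * exp (2 * real t)"
        by (intro mult_right_mono mult_left_mono) auto
      then show ?thesis unfolding r2t weight_def t_def[symmetric] by (simp add: mult_ac)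
    qed
    \<comment> \<open>For odd \<open>i\<close>, \<open>2 * t\<close> exceeds \<open>i\<close> by
      one. The surplus factor \<open>r\<close> is absorbed into \<open>exp r\<close>, which accounts
      for \<open>W + 1\<close> in place of \<open>W\<close> further down.\<close>
    also have "\<dots> \<le> r ^ (i + 1)" using r t by (intro power_increasing)
    also have "\<dots> \<le> r ^ i * exp r"
    proof -
      have "r \<le> exp r" using exp_ge_add_one_self[of r] by linarith
      then have "r ^ i * r \<le> r ^ i * exp r" using r by (intro mult_left_mono) auto
      then show ?thesis by (simp add: mult.commute)
    qed
    finally have w: "weight (2 * N) i / r ^ i \<le> exp (r - 2 * real t)"
      using r by (simp add: field_simps exp_diff)
    have "weight (2 * N) i * \<bar>kern_coeff c W i y\<bar>
      \<le> weight (2 * N) i * (exp (3/2 * c * r^2 + W * r + C) / r ^ i * exp (- (c/8) * y^2))"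
      unfolding C_def using r by (intro mult_left_mono kern_coeff_bound c W weight_nonneg) auto
    also have "\<dots> = (weight (2 * N) i / r ^ i) * (exp (3/2 * c * r^2 + W * r + C) * exp (- (c/8) * y^2))"
      by simp
    also have "\<dots> \<le> exp (r - 2 * real t) * (exp (3/2 * c * r^2 + W * r + C) * exp (- (c/8) * y^2))"
      by (intro mult_right_mono w) auto
    also have "\<dots> = exp (C + (W + 1) * r - real t) * exp (- (c/8) * y^2)"
    proof -
      have "3/2 * c * r^2 = real t" using c\<rho> unfolding r2 by (metis mult.assoc mult_1)
      then show ?thesis by (simp add: algebra_simps flip: exp_add)
    qed
    also have "\<dots> \<le> D * exp (- 1/4) ^ i * exp (- (c/8) * y^2)"
    proof (rule mult_right_mono)
      have "0 \<le> ((W + 1) * \<rho> - sqrt (real t))^2" by simp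
      then have "2 * ((W + 1) * r) \<le> ((W + 1) * \<rho>)^2 + real t"
        by (simp add: power2_eq_square algebra_simps r_def)
      then have "(W + 1) * r \<le> (W + 1)^2 * \<rho>^2 / 2 + real t / 2" by (simp add: power_mult_distrib)
      then have "C + (W + 1) * r - real t \<le> (C + (W + 1)^2 * \<rho>^2 / 2 + 3/2 * c + W) + real i * (- 1/4)"
        using t W c by linarith
      then show "exp (C + (W + 1) * r - real t) \<le> D * exp (- 1/4) ^ i"
        unfolding D_def exp_of_nat_mult[symmetric] exp_add[symmetric] by simp
    qed simp
    finally show ?thesis .
  qed
  then show ?thesis by (intro exI[of _ D]) (auto simp: D_def)
qed

section \<open>Moments of the squared kernel and finite sums for integrals\<close>

lemma measurable_rkern [measurable]: "rkern c W \<in> borel_measurable borel"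
proof -
  have [measurable]: "rsinc \<in> borel_measurable borel"
    unfolding rsinc_def[abs_def] by measurable
  show ?thesis unfolding rkern_def[abs_def] by measurable
qed

lemma rkern_square: "(rkern c W u)^2 = exp (- c * u^2) * (rsinc (W * u))^2"
  by (simp add: rkern_def power_mult_distrib flip: exp_of_nat_mult)

lemma rkern_square_le: "(rkern c W u)^2 \<le> exp (- c * u^2)"
proof -
  have "(rsinc (W * u))^2 \<le> 1" using rsinc_le(1)[of "W * u"] by (simp add: abs_square_le_1)
  then show ?thesis unfolding rkern_square using mult_left_mono[of "(rsinc (W * u))^2" 1 "exp (- c * u^2)"] by simp
qed

lemma integrable_rkern_moment:
  assumes "c > 0"
  shows "integrable lborel (\<lambda>u. u ^ j * (rkern c W u)^2)"
  by (rule Bochner_Integration.integrable_bound[OF integrable_power_gaussian[OF assms, of j]])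
    (use rkern_square_le[of c W] in \<open>auto simp: abs_mult power_abs intro!: AE_I2 mult_left_mono\<close>)

definition kern_moment :: "real \<Rightarrow> real \<Rightarrow> nat \<Rightarrow> real" where
  "kern_moment c W j = (\<integral>u. u ^ j * (rkern c W u)^2 \<partial>lborel)"

lemma kern_moment_1: "kern_moment c W 1 = 0"
proof -
  have "rkern c W (- u) = rkern c W u" for u
    by (simp add: rkern_def rsinc_def)
  then have "kern_moment c W 1 = - kern_moment c W 1"
    using lborel_integral_real_affine[of "-1" "\<lambda>u. u * (rkern c W u)^2" 0]
    by (simp add: kern_moment_def)
  then show ?thesis by simp
qed

text \<open>The mass is at least of order \<open>1 / W\<close>, because the kernel is bounded below
  on an interval of such a length. For \<open>j \<ge> 2\<close> two factors \<open>u\<close> are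
  traded for \<open>1 / W^2\<close>, so these moments are small against the mass for large
  \<open>W\<close>; the first moment vanishes by symmetry.\<close>

lemma kern_moment_concentration:
  assumes c: "c > 0" and \<delta>: "\<delta> > 0"
  shows "\<exists>W>0. kern_moment c W 0 > 0 \<and> (\<forall>j\<in>{1..d}. \<bar>kern_moment c W j\<bar> \<le> \<delta> * kern_moment c W 0)"
proof -
  obtain e where e: "e > 0" "e \<le> 1" "\<And>u. \<bar>u\<bar> \<le> e \<Longrightarrow> rsinc u \<ge> 1/2"
    using rsinc_ge_half by blast
  define A where "A = exp (- c) * e / 2"
  have A: "A > 0" using e by (simp add: A_def)
  define G where "G j = (\<integral>u. \<bar>u\<bar> ^ j * exp (- c * u^2) \<partial>lborel)" for j :: nat
  define S where "S = (\<Sum>j\<le>d. G j)"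
  have G0: "G j \<ge> 0" for j unfolding G_def by (rule Bochner_Integration.integral_nonneg) auto
  \<comment> \<open>Large enough for \<open>S / W^2 \<le> \<delta> * (A / W)\<close>, where
    \<open>A / W\<close> bounds the mass from below and \<open>S / W^2\<close> bounds the moments
    with \<open>j \<ge> 2\<close>.\<close>
  define W where "W = max 1 (S / (\<delta> * A))"
  have W: "W \<ge> 1" by (simp add: W_def)
  have m0: "kern_moment c W 0 \<ge> A / W"
  proof -
    have "A / W = (\<integral>u. exp (- c) / 4 * indicator {- (e/W) .. e/W} u \<partial>lborel)"
      using e W by (simp add: A_def)
    also have "\<dots> \<le> kern_moment c W 0"
      unfolding kern_moment_def
    proof (rule Bochner_Integration.integral_mono)
      show "integrable lborel (\<lambda>u. exp (- c) / 4 * indicator {- (e/W) .. e/W} u)"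
        by (intro integrable_mult_right integrable_real_indicator) (auto simp: emeasure_lborel_Icc_eq)
      show "integrable lborel (\<lambda>u. u ^ 0 * (rkern c W u)^2)"
        by (rule integrable_rkern_moment[OF c])
      fix u :: real
      show "exp (- c) / 4 * indicator {- (e/W) .. e/W} u \<le> u ^ 0 * (rkern c W u)^2"
      proof (cases "u \<in> {- (e/W) .. e/W}")
        case True
        then have u: "\<bar>u\<bar> \<le> e / W" by auto
        then have "\<bar>W * u\<bar> \<le> e" using W by (simp add: abs_mult field_simps)
        then have "(1/2)^2 \<le> (rsinc (W * u))^2" using e(3) by (intro power_mono) auto
        moreover have "\<bar>u\<bar> \<le> 1" using u e W by (smt (verit) divide_le_eq_1_pos le_divide_eq_1_pos)
        then have "u^2 \<le> 1" by (simp add: abs_square_le_1)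
        then have "exp (- c) \<le> exp (- c * u^2)" using c by simp
        ultimately have "exp (- c) * (1/2)^2 \<le> exp (- c * u^2) * (rsinc (W * u))^2"
          by (intro mult_mono) auto
        then show ?thesis unfolding rkern_square using True by (simp add: power2_eq_square)
      qed simp
    qed
    finally show ?thesis .
  qed
  then have pos: "kern_moment c W 0 > 0" using A W by (smt (verit) divide_pos_pos)
  have "\<bar>kern_moment c W j\<bar> \<le> \<delta> * kern_moment c W 0" if j: "j \<in> {1..d}" for j
  proof (cases "j = 1")
    case True
    then show ?thesis using kern_moment_1 pos \<delta> by simp
  next
    case False
    then have j2: "j \<ge> 2" "j - 2 \<le> d" using j by auto
    have "\<bar>kern_moment c W j\<bar> \<le> (\<integral>u. \<bar>u ^ j * (rkern c W u)^2\<bar> \<partial>lborel)"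
      unfolding kern_moment_def by (rule integral_abs_bound)
    also have "\<dots> \<le> (\<integral>u. (1 / W^2) * (\<bar>u\<bar> ^ (j - 2) * exp (- c * u^2)) \<partial>lborel)"
    proof (rule Bochner_Integration.integral_mono)
      show "integrable lborel (\<lambda>u. \<bar>u ^ j * (rkern c W u)^2\<bar>)"
        by (intro integrable_abs integrable_rkern_moment[OF c])
      show "integrable lborel (\<lambda>u. (1 / W^2) * (\<bar>u\<bar> ^ (j - 2) * exp (- c * u^2)))"
        by (intro integrable_mult_right integrable_power_gaussian c)
      fix u :: real
      have "(W * u * rsinc (W * u))^2 \<le> 1" using rsinc_le(2)[of "W * u"] by (simp add: abs_square_le_1)
      then have *: "u^2 * (rsinc (W * u))^2 \<le> 1 / W^2" using W by (simp add: field_simps)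
      have "\<bar>u ^ j * (rkern c W u)^2\<bar> = \<bar>u\<bar> ^ j * (rkern c W u)^2"
        by (simp add: abs_mult power_abs)
      also have "\<bar>u\<bar> ^ j = \<bar>u\<bar> ^ (j - 2) * u^2"
      proof -
        have "\<bar>u\<bar> ^ j = \<bar>u\<bar> ^ (j - 2) * \<bar>u\<bar> ^ 2" using j2 by (metis power_add le_add_diff_inverse2)
        then show ?thesis by (simp only: power2_abs)
      qed
      also have "\<dots> * (rkern c W u)^2 = (\<bar>u\<bar> ^ (j - 2) * exp (- c * u^2)) * (u^2 * (rsinc (W * u))^2)"
        by (simp add: rkern_square)
      also have "\<dots> \<le> (\<bar>u\<bar> ^ (j - 2) * exp (- c * u^2)) * (1 / W^2)"
        by (intro mult_left_mono *) auto
      finally show "\<bar>u ^ j * (rkern c W u)^2\<bar> \<le> (1 / W^2) * (\<bar>u\<bar> ^ (j - 2) * exp (- c * u^2))"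
        by (simp only: mult.commute)
    qed
    also have "\<dots> = G (j - 2) / W^2" by (simp add: G_def)
    also have "\<dots> \<le> S / W^2"
      unfolding S_def using j2 G0 W by (intro divide_right_mono member_le_sum) auto
    also have "\<dots> \<le> \<delta> * (A / W)"
    proof -
      have "S / (\<delta> * A) \<le> W" by (simp add: W_def)
      then have "S \<le> W * (\<delta> * A)" using \<delta> A by (simp add: pos_divide_le_eq)
      then have "S / W^2 \<le> W * (\<delta> * A) / W^2" by (intro divide_right_mono) auto
      also have "\<dots> = \<delta> * (A / W)" using W by (simp add: power2_eq_square)
      finally show ?thesis .
    qed
    also have "\<dots> \<le> \<delta> * kern_moment c W 0" using m0 \<delta> by (intro mult_left_mono) auto
    finally show ?thesis .
  qed
  then show ?thesis using pos W by (intro exI[of _ W]) auto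
qed

text \<open>The Lebesgue integral is a gauge integral, so on one sufficiently large interval a
  tagged division fine for the intersection of finitely many gauges serves all the functions at
  once. An element of \<open>P\<close> is a tag with its cell, and the lengths of the cells give
  nonnegative weights.\<close>

lemma common_quadrature:
  fixes \<phi> :: "'i \<Rightarrow> real \<Rightarrow> real"
  assumes fin: "finite I" and int: "\<And>i. i \<in> I \<Longrightarrow> integrable lborel (\<phi> i)" and e: "e > 0"
  shows "\<exists>P :: (real \<times> real set) set. finite P \<and>
    (\<forall>i\<in>I. \<bar>(\<Sum>j\<in>P. measure lborel (snd j) * \<phi> i (fst j)) - (\<integral>x. \<phi> i x \<partial>lborel)\<bar> \<le> e)"
proof -
  have "\<exists>B>0. \<forall>a b. ball 0 B \<subseteq> cbox a b \<longrightarrow>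
     (\<exists>z. (\<phi> i has_integral z) (cbox a b) \<and> \<bar>z - (\<integral>x. \<phi> i x \<partial>lborel)\<bar> < e/2)" if i: "i \<in> I" for i
  proof -
    have nb: "\<not> (\<exists>a b. (UNIV :: real set) = cbox a b)" by (metis bounded_cbox not_bounded_UNIV)
    obtain B where "B > 0" "\<forall>a b. ball 0 B \<subseteq> cbox a b \<longrightarrow>
      (\<exists>z. ((\<lambda>x. if x \<in> UNIV then \<phi> i x else 0) has_integral z) (cbox a b) \<and>
        norm (z - (\<integral>x. \<phi> i x \<partial>lborel)) < e/2)"
      by (rule has_integral_altD[OF has_integral_integral_lborel[OF int[OF i]] nb, of "e/2"]) (use e in auto)
    then show ?thesis by auto
  qed
  then obtain B where B: "\<And>i. i \<in> I \<Longrightarrow> B i > 0"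
    "\<And>i a b. i \<in> I \<Longrightarrow> ball 0 (B i) \<subseteq> cbox a b \<Longrightarrow>
     (\<exists>z. (\<phi> i has_integral z) (cbox a b) \<and> \<bar>z - (\<integral>x. \<phi> i x \<partial>lborel)\<bar> < e/2)"
    by metis
  define R where "R = (\<Sum>i\<in>I. B i)"
  have BR: "B i \<le> R" if "i \<in> I" for i
    unfolding R_def using that fin B(1) by (intro member_le_sum) (auto intro: less_imp_le)
  have "\<exists>z. (\<phi> i has_integral z) (cbox (-R) R) \<and> \<bar>z - (\<integral>x. \<phi> i x \<partial>lborel)\<bar> < e/2" if "i \<in> I" for i
    by (rule B(2)[OF that]) (use BR[OF that] in \<open>auto simp: dist_real_def\<close>)
  then obtain z where z: "\<And>i. i \<in> I \<Longrightarrow> (\<phi> i has_integral z i) (cbox (-R) R)"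
    "\<And>i. i \<in> I \<Longrightarrow> \<bar>z i - (\<integral>x. \<phi> i x \<partial>lborel)\<bar> < e/2"
    by metis
  have "\<exists>\<gamma>. gauge \<gamma> \<and> (\<forall>D. D tagged_division_of (cbox (-R) R) \<and> \<gamma> fine D \<longrightarrow>
      norm ((\<Sum>(x, k)\<in>D. measure lborel k *\<^sub>R \<phi> i x) - z i) < e/2)" if "i \<in> I" for i
    using z(1)[OF that] e unfolding has_integral by (meson half_gt_zero)
  then obtain \<gamma> where \<gamma>: "\<And>i. i \<in> I \<Longrightarrow> gauge (\<gamma> i)"
    "\<And>i D. i \<in> I \<Longrightarrow> D tagged_division_of (cbox (-R) R) \<Longrightarrow> \<gamma> i fine D \<Longrightarrow>
      norm ((\<Sum>(x, k)\<in>D. measure lborel k *\<^sub>R \<phi> i x) - z i) < e/2"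
    by metis
  obtain D where D: "D tagged_division_of (cbox (-R) R)" "(\<lambda>x. \<Inter>{\<gamma> i x | i. i \<in> I}) fine D"
    by (rule fine_division_exists[OF gauge_Inter[OF fin \<gamma>(1)]])
  have "\<bar>(\<Sum>j\<in>D. measure lborel (snd j) * \<phi> i (fst j)) - (\<integral>x. \<phi> i x \<partial>lborel)\<bar> \<le> e" if i: "i \<in> I" for i
  proof -
    have "\<gamma> i fine D" using D(2) i by (simp add: fine_Inter)
    from \<gamma>(2)[OF i D(1) this]
    have "\<bar>(\<Sum>j\<in>D. measure lborel (snd j) * \<phi> i (fst j)) - z i\<bar> < e/2"
      by (simp add: case_prod_unfold)
    with z(2)[OF i] show ?thesis by linarith
  qed
  then show ?thesis using D(1) by blast
qed

section \<open>Univariate quadrature by squares\<close>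

text \<open>Stated for an arbitrary family \<open>s y\<close> with a Gaussian bound, to cover both
  the Taylor coefficients of the kernel and their truncation. Squaring doubles the decay rate from
  \<open>c/8\<close> to \<open>c/4\<close>.\<close>

lemma
  fixes s :: "real \<Rightarrow> nat \<Rightarrow> real"
  assumes N: "N \<ge> 1" and c: "c > 0" and D: "D \<ge> 0" and q: "q \<ge> 0"
    and meas: "\<And>k. (\<lambda>y. s y k) \<in> borel_measurable borel"
    and bound: "\<And>y k. weight (2 * N) k * \<bar>s y k\<bar> \<le> D * q ^ k * exp (- (c/8) * y^2)"
  shows integrable_sq_coeff: "integrable lborel (\<lambda>y. y ^ b * sq_coeff (s y) l)"
    and integral_sq_coeff_le: "weight N l * (\<integral>y. \<bar>y ^ b * sq_coeff (s y) l\<bar> \<partial>lborel)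
      \<le> D^2 * (real (l + 1) * q ^ l) * (\<integral>y. \<bar>y\<bar> ^ b * exp (- (c/4) * y^2) \<partial>lborel)"
    and weight_sq_coeff_le: "weight N l * \<bar>sq_coeff (s y) l\<bar>
      \<le> D^2 * (real (l + 1) * q ^ l) * exp (- (c/4) * y^2)"
proof -
  have le: "weight N l * \<bar>sq_coeff (s y) l\<bar> \<le> D^2 * (real (l + 1) * q ^ l) * exp (- (c/4) * y^2)" for y l
  proof -
    have "weight N l * \<bar>sq_coeff (s y) l\<bar> \<le> (D * exp (- (c/8) * y^2))^2 * (real (l + 1) * q ^ l)"
      by (rule sq_coeff_bound[OF N]) (use bound D q in \<open>auto simp: mult_ac\<close>)
    also have "\<dots> = D^2 * (real (l + 1) * q ^ l) * exp (- (c/4) * y^2)"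
      by (simp add: power_mult_distrib flip: exp_of_nat_mult)
    finally show ?thesis .
  qed
  show "weight N l * \<bar>sq_coeff (s y) l\<bar> \<le> D^2 * (real (l + 1) * q ^ l) * exp (- (c/4) * y^2)"
    by (rule le)
  have wle: "weight N l * \<bar>y ^ b * sq_coeff (s y) l\<bar>
      \<le> D^2 * (real (l + 1) * q ^ l) * (\<bar>y\<bar> ^ b * exp (- (c/4) * y^2))" for y
    using mult_left_mono[OF le[of l y], of "\<bar>y\<bar> ^ b"] by (simp add: abs_mult power_abs mult_ac)
  have [measurable]: "(\<lambda>y. y ^ b * sq_coeff (s y) l) \<in> borel_measurable borel"
    unfolding sq_coeff_def using meas by measurable
  have gi: "integrable lborel (\<lambda>y. D^2 * (real (l + 1) * q ^ l) * (\<bar>y\<bar> ^ b * exp (- (c/4) * y^2)))"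
    by (intro integrable_mult_right integrable_power_gaussian) (use c in auto)
  show int: "integrable lborel (\<lambda>y. y ^ b * sq_coeff (s y) l)"
  proof (rule Bochner_Integration.integrable_bound[OF gi])
    have "\<bar>y ^ b * sq_coeff (s y) l\<bar> \<le> D^2 * (real (l + 1) * q ^ l) * (\<bar>y\<bar> ^ b * exp (- (c/4) * y^2))" for y
      using wle[of y] mult_right_mono[OF weight_ge_1[OF N, of l], of "\<bar>y ^ b * sq_coeff (s y) l\<bar>"] by simp
    then show "AE y in lborel. norm (y ^ b * sq_coeff (s y) l)
        \<le> norm (D^2 * (real (l + 1) * q ^ l) * (\<bar>y\<bar> ^ b * exp (- (c/4) * y^2)))"
      by (intro AE_I2) (smt (verit) real_norm_def)
  qed simp
  have "weight N l * (\<integral>y. \<bar>y ^ b * sq_coeff (s y) l\<bar> \<partial>lborel) = (\<integral>y. weight N l * \<bar>y ^ b * sq_coeff (s y) l\<bar> \<partial>lborel)"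
    by simp
  also have "\<dots> \<le> (\<integral>y. D^2 * (real (l + 1) * q ^ l) * (\<bar>y\<bar> ^ b * exp (- (c/4) * y^2)) \<partial>lborel)"
    by (intro Bochner_Integration.integral_mono gi wle integrable_mult_right integrable_abs int)
  also have "\<dots> = D^2 * (real (l + 1) * q ^ l) * (\<integral>y. \<bar>y\<bar> ^ b * exp (- (c/4) * y^2) \<partial>lborel)"
    by simp
  finally show "weight N l * (\<integral>y. \<bar>y ^ b * sq_coeff (s y) l\<bar> \<partial>lborel)
      \<le> D^2 * (real (l + 1) * q ^ l) * (\<integral>y. \<bar>y\<bar> ^ b * exp (- (c/4) * y^2) \<partial>lborel)" .
qed

lemma summable_Suc_geometric:
  fixes q :: real
  assumes "0 \<le> q" "q < 1"
  shows "summable (\<lambda>l. real (l + 1) * q ^ l)"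
  using geometric_deriv_sums[of q] assms by (auto simp: sums_iff)

lemma measurable_kern_coeff: "kern_coeff c W k \<in> borel_measurable borel"
  by (rule borel_measurable_continuous_onI[OF continuous_kern_coeff])

text \<open>The integral of \<open>y ^ b * (rkern c W (x - y))^2\<close> over \<open>y\<close> is
  expanded in powers of \<open>x\<close> twice: by integrating the squared Taylor series term by
  term, and by substituting \<open>u = x - y\<close> and expanding \<open>(x - u) ^ b\<close>. The
  coefficients are then compared.\<close>

lemma kern_coeff_moments:
  assumes N: "N \<ge> 1" and c: "c > 0" and D: "D \<ge> 0" and q: "0 \<le> q" "q < 1"
    and bound: "\<And>k y. weight (2 * N) k * \<bar>kern_coeff c W k y\<bar> \<le> D * q ^ k * exp (- (c/8) * y^2)"
  shows "(\<integral>y. y ^ b * sq_coeff (\<lambda>k. kern_coeff c W k y) l \<partial>lborel)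
    = (if l \<le> b then real (b choose l) * (- 1) ^ (b - l) * kern_moment c W (b - l) else 0)"
proof -
  define S where "S y = sq_coeff (\<lambda>k. kern_coeff c W k y)" for y
  note int = integrable_sq_coeff[where s = "\<lambda>y k. kern_coeff c W k y", OF N c D q(1) measurable_kern_coeff bound, folded S_def]
  note ile = integral_sq_coeff_le[where s = "\<lambda>y k. kern_coeff c W k y", OF N c D q(1) measurable_kern_coeff bound, folded S_def]
  note ple = weight_sq_coeff_le[where s = "\<lambda>y k. kern_coeff c W k y", OF N c D q(1) measurable_kern_coeff bound, folded S_def]
  have sumq: "summable (\<lambda>l. real (l + 1) * q ^ l)" using q by (rule summable_Suc_geometric)
  define f where "f x = (\<integral>y. y ^ b * (rkern c W (x - y))^2 \<partial>lborel)" for x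
  have w1: "weight (2 * N) k \<ge> 1" "weight N k \<ge> 1" for k using N by (auto intro!: weight_ge_1)
  \<comment> \<open>For \<open>\<bar>x\<bar> < 1\<close> the powers of \<open>x\<close> are at most
    1, hence below the weights, so the weighted bounds dominate every series that occurs.\<close>
  have "(\<lambda>l. (\<integral>y. y ^ b * S y l \<partial>lborel) * x ^ l) sums f x" if x: "\<bar>x\<bar> < 1" for x
  proof -
    have xl: "\<bar>x\<bar> ^ l \<le> 1" for l using x by (intro power_le_one) auto
    have ps: "(\<lambda>l. S y l * x ^ l) sums (rkern c W (x - y))^2" for y
    proof -
      have "summable (\<lambda>k. norm (kern_coeff c W k y * x ^ k))"
      proof (rule summable_comparison_test)
        show "summable (\<lambda>k. D * exp (- (c/8) * y^2) * q ^ k)"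
          using q by (intro summable_mult summable_geometric) auto
        have "norm (norm (kern_coeff c W k y * x ^ k)) \<le> D * exp (- (c/8) * y^2) * q ^ k" for k
        proof -
          have "\<bar>kern_coeff c W k y\<bar> * \<bar>x\<bar> ^ k \<le> weight (2 * N) k * \<bar>kern_coeff c W k y\<bar>"
            using mult_left_mono[OF xl[of k], of "\<bar>kern_coeff c W k y\<bar>"]
              mult_right_mono[OF w1(1)[of k], of "\<bar>kern_coeff c W k y\<bar>"] by simp
          also have "\<dots> \<le> D * exp (- (c/8) * y^2) * q ^ k" using bound[of k y] by (simp add: mult_ac)
          finally show ?thesis by (simp add: abs_mult power_abs)
        qed
        then show "\<exists>n0. \<forall>k\<ge>n0. norm (norm (kern_coeff c W k y * x ^ k)) \<le> D * exp (- (c/8) * y^2) * q ^ k"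
          by blast
      qed
      from Cauchy_product_sums[OF this this]
      have "(\<lambda>l. \<Sum>k\<le>l. (kern_coeff c W k y * x ^ k) * (kern_coeff c W (l - k) y * x ^ (l - k))) sums (rkern c W (x - y))^2"
        using kern_coeff_sums[of c W y x] by (simp add: sums_iff power2_eq_square)
      moreover have "(\<Sum>k\<le>l. (kern_coeff c W k y * x ^ k) * (kern_coeff c W (l - k) y * x ^ (l - k))) = S y l * x ^ l" for l
        unfolding S_def sq_coeff_def sum_distrib_right
        by (intro sum.cong) (auto simp: mult_ac simp flip: power_add)
      ultimately show ?thesis by simp
    qed
    let ?g = "\<lambda>l y. y ^ b * S y l * x ^ l"
    have "(\<lambda>l. \<integral>y. ?g l y \<partial>lborel) sums (\<integral>y. suminf (\<lambda>l. ?g l y) \<partial>lborel)"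
    proof (rule sums_integral)
      show "integrable lborel (?g l)" for l using int[of b l] by (intro integrable_mult_left)
      show "AE y in lborel. summable (\<lambda>l. norm (?g l y))"
      proof (rule AE_I2, rule summable_comparison_test)
        fix y
        let ?C = "\<bar>y\<bar> ^ b * (D^2 * exp (- (c/4) * y^2))"
        show "summable (\<lambda>l. ?C * (real (l + 1) * q ^ l))" by (rule summable_mult[OF sumq])
        have "norm (norm (?g l y)) \<le> ?C * (real (l + 1) * q ^ l)" for l
        proof -
          have "\<bar>S y l\<bar> * \<bar>x\<bar> ^ l \<le> weight N l * \<bar>S y l\<bar>"
            using mult_left_mono[OF xl[of l], of "\<bar>S y l\<bar>"]
              mult_right_mono[OF w1(2)[of l], of "\<bar>S y l\<bar>"] by simp
          also have "\<dots> \<le> D^2 * (real (l + 1) * q ^ l) * exp (- (c/4) * y^2)" by (rule ple)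
          finally have "\<bar>y\<bar> ^ b * (\<bar>S y l\<bar> * \<bar>x\<bar> ^ l) \<le> \<bar>y\<bar> ^ b * (D^2 * (real (l + 1) * q ^ l) * exp (- (c/4) * y^2))"
            by (rule mult_left_mono) simp
          then show ?thesis by (simp add: abs_mult power_abs mult_ac)
        qed
        then show "\<exists>n0. \<forall>l\<ge>n0. norm (norm (?g l y)) \<le> ?C * (real (l + 1) * q ^ l)" by blast
      qed
      show "summable (\<lambda>l. \<integral>y. norm (?g l y) \<partial>lborel)"
      proof (rule summable_comparison_test)
        let ?G = "\<integral>y. \<bar>y\<bar> ^ b * exp (- (c/4) * y^2) \<partial>lborel"
        show "summable (\<lambda>l. D^2 * ?G * (real (l + 1) * q ^ l))" by (rule summable_mult[OF sumq])
        have "norm (\<integral>y. norm (?g l y) \<partial>lborel) \<le> D^2 * ?G * (real (l + 1) * q ^ l)" for l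
        proof -
          let ?J = "\<integral>y. \<bar>y ^ b * S y l\<bar> \<partial>lborel"
          have J: "?J \<ge> 0" by (rule Bochner_Integration.integral_nonneg) simp
          have "norm (\<integral>y. norm (?g l y) \<partial>lborel) = ?J * \<bar>x\<bar> ^ l"
            using J by (simp add: abs_mult power_abs)
          also have "\<dots> \<le> weight N l * ?J"
            using mult_left_mono[OF xl[of l] J] mult_right_mono[OF w1(2)[of l] J] by simp
          also have "\<dots> \<le> D^2 * (real (l + 1) * q ^ l) * ?G" by (rule ile)
          finally show ?thesis by (simp add: mult_ac)
        qed
        then show "\<exists>n0. \<forall>l\<ge>n0. norm (\<integral>y. norm (?g l y) \<partial>lborel) \<le> D^2 * ?G * (real (l + 1) * q ^ l)"
          by blast
      qed
    qed
    moreover have "suminf (\<lambda>l. ?g l y) = y ^ b * (rkern c W (x - y))^2" for y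
      using sums_mult[OF ps[of y], of "y ^ b"] by (simp add: sums_iff mult.assoc)
    ultimately show ?thesis by (simp add: f_def)
  qed
  moreover have "(\<lambda>l. (if l \<le> b then real (b choose l) * (- 1) ^ (b - l) * kern_moment c W (b - l) else 0) * x ^ l) sums f x" for x
  proof -
    have "f x = (\<integral>u. (x - u) ^ b * (rkern c W u)^2 \<partial>lborel)"
      unfolding f_def by (subst lborel_integral_real_affine[of "-1" _ x]) auto
    also have "\<dots> = (\<integral>u. (\<Sum>l\<le>b. real (b choose l) * x ^ l * (- 1) ^ (b - l) * (u ^ (b - l) * (rkern c W u)^2)) \<partial>lborel)"
    proof (rule Bochner_Integration.integral_cong[OF refl])
      fix u
      have "(x - u) ^ b = (\<Sum>l\<le>b. real (b choose l) * x ^ l * (- u) ^ (b - l))"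
        using binomial_ring[of x "- u" b] by simp
      then show "(x - u) ^ b * (rkern c W u)^2
        = (\<Sum>l\<le>b. real (b choose l) * x ^ l * (- 1) ^ (b - l) * (u ^ (b - l) * (rkern c W u)^2))"
        by (simp only: sum_distrib_right) (simp add: power_minus[of u] mult_ac)
    qed
    also have "\<dots> = (\<Sum>l\<le>b. real (b choose l) * x ^ l * (- 1) ^ (b - l) * kern_moment c W (b - l))"
      unfolding kern_moment_def
      by (subst Bochner_Integration.integral_sum) (auto intro!: integrable_mult_right integrable_rkern_moment[OF c])
    finally have "f x = (\<Sum>l\<le>b. (if l \<le> b then real (b choose l) * (- 1) ^ (b - l) * kern_moment c W (b - l) else 0) * x ^ l)"
      by (simp add: mult_ac)
    then show ?thesis by (simp only:) (rule sums_finite, auto)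
  qed
  ultimately have "(\<integral>y. y ^ b * S y l \<partial>lborel)
    = (if l \<le> b then real (b choose l) * (- 1) ^ (b - l) * kern_moment c W (b - l) else 0)"
    by (rule powser_unique)
  then show ?thesis by (simp add: S_def)
qed

text \<open>The error has three sources, each allotted \<open>h / 3\<close>: the kernel moments of
  positive order, at indices \<open>l \<le> d\<close>; truncation of the Taylor series, at indices
  \<open>l > T\<close>; and the replacement of integrals by finite sums. Accordingly
  \<open>W\<close>, \<open>T\<close> and \<open>P\<close> are chosen in this order.\<close>

lemma univariate_quadrature:
  fixes h :: real
  assumes N: "N \<ge> 1" and h: "h > 0"
  shows "\<exists>T (P :: (real \<times> real set) set) c y s. finite P \<and> (\<forall>j\<in>P. c j \<ge> 0) \<and>
    (\<forall>j l. l > T \<longrightarrow> s j l = 0) \<and> d \<le> 2 * T \<and>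
    (\<forall>b\<le>d. (\<Sum>l\<le>2 * T. weight N l *
       \<bar>(\<Sum>j\<in>P. c j * y j ^ b * sq_coeff (s j) l) - of_bool (l = b)\<bar>) \<le> h)"
proof -
  define c where "c = kern_width N"
  have c: "c > 0" using N by (simp add: c_def kern_width_def)
  define q :: real where "q = exp (- 1/4)"
  have q: "0 \<le> q" "q < 1" by (simp_all add: q_def)
  \<comment> \<open>The factor \<open>2 ^ d\<close> bounds the binomial coefficients that multiply
    the moments.\<close>
  define \<delta> where "\<delta> = h / (3 * (1 + (\<Sum>l\<le>d. weight N l * 2 ^ d)))"
  have sw: "(\<Sum>l\<le>d. weight N l * 2 ^ d) \<ge> 0" by (intro sum_nonneg mult_nonneg_nonneg weight_nonneg) auto
  have \<delta>: "\<delta> > 0" using h sw by (simp add: \<delta>_def)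
  obtain W where W: "W > 0" and m0: "kern_moment c W 0 > 0"
    and mj: "\<And>j. j \<in> {1..d} \<Longrightarrow> \<bar>kern_moment c W j\<bar> \<le> \<delta> * kern_moment c W 0"
    using kern_moment_concentration[OF c \<delta>] by blast
  define m where "m = kern_moment c W 0"
  have m: "m > 0" using m0 by (simp add: m_def)
  obtain D where D: "D \<ge> 0" and bound: "\<And>i y. weight (2 * N) i * \<bar>kern_coeff c W i y\<bar> \<le> D * q ^ i * exp (- (c/8) * y^2)"
    using kern_coeff_weight_bound[OF N, of W] W unfolding c_def q_def by auto
  define G where "G b = (\<integral>y. \<bar>y\<bar> ^ b * exp (- (c/4) * y^2) \<partial>lborel)" for b :: nat
  have G0: "G b \<ge> 0" for b unfolding G_def by (rule Bochner_Integration.integral_nonneg) simp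
  define M where "M = D^2 * (\<Sum>b\<le>d. G b) / m"
  have M0: "M \<ge> 0" unfolding M_def using m G0 by (intro divide_nonneg_pos mult_nonneg_nonneg sum_nonneg) auto
  have GM: "D^2 * G b / m \<le> M" if "b \<le> d" for b
    unfolding M_def using that m G0 by (intro divide_right_mono mult_left_mono member_le_sum) auto
  define a where "a l = M * (real (l + 1) * q ^ l)" for l
  have a0: "a l \<ge> 0" for l using M0 q by (simp add: a_def)
  have suma: "summable a"
    unfolding a_def[abs_def] by (intro summable_mult summable_Suc_geometric q)
  obtain T0 where T0: "\<And>i j. i \<ge> T0 \<Longrightarrow> norm (sum a {i..<j}) < h / 3"
    using suma h unfolding summable_Cauchy by (metis divide_pos_pos zero_less_numeral)
  define T where "T = max T0 d"
  have T: "T \<ge> d" "T \<ge> T0" by (auto simp: T_def)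
  define s where "s y k = (if k \<le> T then kern_coeff c W k y else 0)" for y k
  have s_meas: "(\<lambda>y. s y k) \<in> borel_measurable borel" for k
    using measurable_kern_coeff[of c W k] by (cases "k \<le> T") (simp_all add: s_def)
  have s_bound: "weight (2 * N) k * \<bar>s y k\<bar> \<le> D * q ^ k * exp (- (c/8) * y^2)" for k y
    using bound[of k y] D q by (auto simp: s_def)
  note s_int = integrable_sq_coeff[OF N c D q(1) s_meas s_bound]
  note s_le = integral_sq_coeff_le[OF N c D q(1) s_meas s_bound, folded G_def]
  \<comment> \<open>The coefficient of index \<open>l\<close> after truncation and normalisation by
    the mass \<open>m\<close>, but before discretisation.\<close>
  define E where "E b l = (\<integral>y. y ^ b * sq_coeff (s y) l / m \<partial>lborel)" for b l
  define X where "X = (\<Sum>l\<le>2 * T. weight N l)"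
  have X0: "X \<ge> 0" unfolding X_def by (intro sum_nonneg weight_nonneg)
  define e where "e = h / (3 * (1 + X))"
  have e: "e > 0" using h X0 by (simp add: e_def)
  obtain P :: "(real \<times> real set) set" where P: "finite P"
    and PE: "\<And>b l. b \<le> d \<Longrightarrow> l \<le> 2 * T \<Longrightarrow>
      \<bar>(\<Sum>j\<in>P. measure lborel (snd j) * (fst j ^ b * sq_coeff (s (fst j)) l / m)) - E b l\<bar> \<le> e"
  proof -
    have "\<exists>P :: (real \<times> real set) set. finite P \<and>
      (\<forall>i\<in>{..d} \<times> {..2 * T}. \<bar>(\<Sum>j\<in>P. measure lborel (snd j) *
        (fst j ^ fst i * sq_coeff (s (fst j)) (snd i) / m)) - (\<integral>y. y ^ fst i * sq_coeff (s y) (snd i) / m \<partial>lborel)\<bar> \<le> e)"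
      by (rule common_quadrature[of _ "\<lambda>i y. y ^ fst i * sq_coeff (s y) (snd i) / m"])
        (use e s_int in auto)
    then show ?thesis using that unfolding E_def by fastforce
  qed
  define u where "u b l = (\<Sum>j\<in>P. (measure lborel (snd j) / m) * fst j ^ b * sq_coeff (s (fst j)) l)" for b l
  have uE: "\<bar>u b l - E b l\<bar> \<le> e" if "b \<le> d" "l \<le> 2 * T" for b l
  proof -
    have "u b l = (\<Sum>j\<in>P. measure lborel (snd j) * (fst j ^ b * sq_coeff (s (fst j)) l / m))"
      unfolding u_def by (intro sum.cong refl) simp
    then show ?thesis using PE[OF that] by (simp only:)
  qed
  \<comment> \<open>Coefficients of the square up to index \<open>T\<close> only involve
    \<open>s y k\<close> with \<open>k \<le> T\<close>, so truncation leaves them exact.\<close>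
  have E_low: "E b l = (if l \<le> b then real (b choose l) * (- 1) ^ (b - l) * kern_moment c W (b - l) / m else 0)"
    if "l \<le> T" for b l
  proof -
    have "sq_coeff (s y) l = sq_coeff (\<lambda>k. kern_coeff c W k y) l" for y
      unfolding sq_coeff_def using that by (intro sum.cong) (auto simp: s_def)
    then show ?thesis
      using kern_coeff_moments[OF N c D q bound, of b l] by (simp add: E_def)
  qed
  have E_low_le: "\<bar>E b l - of_bool (l = b)\<bar> \<le> (if l \<le> d then 2 ^ d * \<delta> else 0)" if b: "b \<le> d" and l: "l \<le> T" for b l
  proof -
    consider "l < b" | "l = b" | "l > b" by linarith
    then show ?thesis
    proof cases
      case 1
      have "\<bar>kern_moment c W (b - l)\<bar> \<le> \<delta> * m" unfolding m_def using 1 b by (intro mj) auto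
      then have "\<bar>kern_moment c W (b - l) / m\<bar> \<le> \<delta>" using m by (simp add: field_simps)
      moreover have "real (b choose l) \<le> 2 ^ d"
      proof -
        have "real (b choose l) \<le> 2 ^ b" using binomial_le_pow2[of b l] by (metis of_nat_le_iff of_nat_numeral of_nat_power)
        also have "\<dots> \<le> 2 ^ d" using b by (intro power_increasing) auto
        finally show ?thesis .
      qed
      ultimately have "real (b choose l) * \<bar>kern_moment c W (b - l) / m\<bar> \<le> 2 ^ d * \<delta>"
        by (intro mult_mono) auto
      then show ?thesis using 1 b by (simp add: E_low[OF l] abs_mult power_abs)
    next
      case 2
      then have "E b l = 1" using E_low[of b b] l m by (simp add: m_def)
      then show ?thesis using \<delta> 2 by simp
    next
      case 3
      then show ?thesis using \<delta> by (simp add: E_low[OF l])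
    qed
  qed
  \<comment> \<open>Beyond \<open>T\<close> the exact formula is no longer available for the
    truncated square, and this decay bound takes its place.\<close>
  have E_high: "weight N l * \<bar>E b l\<bar> \<le> a l" if b: "b \<le> d" for b l
  proof -
    have "\<bar>E b l\<bar> \<le> (\<integral>y. \<bar>y ^ b * sq_coeff (s y) l\<bar> \<partial>lborel) / m"
      unfolding E_def using m integral_abs_bound[of lborel "\<lambda>y. y ^ b * sq_coeff (s y) l"]
      by (simp add: divide_right_mono)
    then have "weight N l * \<bar>E b l\<bar> \<le> weight N l * ((\<integral>y. \<bar>y ^ b * sq_coeff (s y) l\<bar> \<partial>lborel) / m)"
      by (rule mult_left_mono) (rule weight_nonneg)
    also have "\<dots> \<le> D^2 * (real (l + 1) * q ^ l) * G b / m"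
      using divide_right_mono[OF s_le[of l b], of m] m by simp
    also have "\<dots> = (D^2 * G b / m) * (real (l + 1) * q ^ l)" by (simp add: mult_ac)
    also have "\<dots> \<le> a l" unfolding a_def using GM[OF b] q by (intro mult_right_mono) auto
    finally show ?thesis .
  qed
  have main: "(\<Sum>l\<le>2 * T. weight N l * \<bar>u b l - of_bool (l = b)\<bar>) \<le> h" if b: "b \<le> d" for b
  proof -
    have "(\<Sum>l\<le>2 * T. weight N l * \<bar>u b l - of_bool (l = b)\<bar>)
      \<le> (\<Sum>l\<le>2 * T. weight N l * e + weight N l * \<bar>E b l - of_bool (l = b)\<bar>)"
    proof (rule sum_mono)
      fix l assume "l \<in> {..2 * T}"
      then have "\<bar>u b l - of_bool (l = b)\<bar> \<le> e + \<bar>E b l - of_bool (l = b)\<bar>"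
        using uE[OF b, of l] by auto
      from mult_left_mono[OF this weight_nonneg[of N l]]
      show "weight N l * \<bar>u b l - of_bool (l = b)\<bar> \<le> weight N l * e + weight N l * \<bar>E b l - of_bool (l = b)\<bar>"
        by (simp only: distrib_left)
    qed
    also have "\<dots> = X * e + (\<Sum>l\<le>2 * T. weight N l * \<bar>E b l - of_bool (l = b)\<bar>)"
      by (simp add: sum.distrib X_def sum_distrib_right)
    \<comment> \<open>For \<open>d < l \<le> T\<close> there is no error at all; for
      \<open>l > T\<close> the target coefficient is 0, since
      \<open>b \<le> d \<le> T\<close>.\<close>
    also have "(\<Sum>l\<le>2 * T. weight N l * \<bar>E b l - of_bool (l = b)\<bar>)
      \<le> (\<Sum>l\<le>2 * T. (if l \<le> d then weight N l * (2 ^ d * \<delta>) else 0) + (if l \<ge> Suc T then a l else 0))"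
    proof (rule sum_mono)
      fix l assume "l \<in> {..2 * T}"
      show "weight N l * \<bar>E b l - of_bool (l = b)\<bar>
        \<le> (if l \<le> d then weight N l * (2 ^ d * \<delta>) else 0) + (if l \<ge> Suc T then a l else 0)"
      proof (cases "l \<le> T")
        case True
        then show ?thesis
          using mult_left_mono[OF E_low_le[OF b True] weight_nonneg[of N l]] by (auto split: if_splits)
      next
        case False
        then show ?thesis using E_high[OF b, of l] T b by auto
      qed
    qed
    also have "\<dots> = (\<Sum>l\<le>d. weight N l * (2 ^ d * \<delta>)) + sum a {Suc T..<Suc (2 * T)}"
    proof -
      have "{..2 * T} \<inter> {l. l \<le> d} = {..d}" "{..2 * T} \<inter> {l. Suc T \<le> l} = {Suc T..<Suc (2 * T)}"
        using T by auto
      then show ?thesis by (simp add: sum.distrib sum.If_cases)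
    qed
    also have "(\<Sum>l\<le>d. weight N l * (2 ^ d * \<delta>)) \<le> h / 3"
    proof -
      have "(\<Sum>l\<le>d. weight N l * (2 ^ d * \<delta>)) = (\<Sum>l\<le>d. weight N l * 2 ^ d) * \<delta>"
        by (simp add: sum_distrib_right mult.assoc)
      also have "\<dots> \<le> h / 3" using h sw by (simp add: \<delta>_def field_simps)
      finally show ?thesis .
    qed
    also have "sum a {Suc T..<Suc (2 * T)} \<le> h / 3"
      using T0[of "Suc T" "Suc (2 * T)"] T by (simp add: abs_less_iff)
    also have "X * e \<le> h / 3" using h X0 by (simp add: e_def field_simps)
    finally show ?thesis by simp
  qed
  show ?thesis
    by (intro exI[of _ T] exI[of _ P] exI[of _ "\<lambda>j. measure lborel (snd j) / m"] exI[of _ fst] exI[of _ "\<lambda>j. s (fst j)"])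
      (use P m T main in \<open>auto simp: u_def s_def\<close>)
qed

section \<open>Nonnegative polynomials\<close>

lemma sum_of_squares_perturbation:
  fixes p :: "'n::finite rpoly"
  assumes p: "\<And>x. eval p x \<ge> 0" and e: "e > 0"
  shows "\<exists>r. sum_of_squares (p + Const e * perturbation r)"
proof -
  define N where "N = CARD('n)"
  have "N \<ge> 1" by (simp add: N_def Suc_le_eq)
  define K :: real where "K = fact N"
  define d where "d = total_degree p"
  let ?M = "Poly_Mapping.keys p"
  let ?lk = "Poly_Mapping.lookup"
  have d: "?lk \<alpha> i \<le> d" if "\<alpha> \<in> ?M" for \<alpha> i
  proof -
    have "?lk \<alpha> i \<le> (\<Sum>i\<in>UNIV. ?lk \<alpha> i)" by (rule member_le_sum) auto
    also have "\<dots> \<le> d" using that total_degree_le_iff[of p d] by (simp add: d_def)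
    finally show ?thesis .
  qed
  \<comment> \<open>The total absorption cost when each one-variable error is at most
    \<open>h\<close>. It is continuous and vanishes at 0, which yields the choice of
    \<open>h\<close>.\<close>
  define H where "H h = (\<Sum>\<alpha>\<in>?M. \<bar>?lk p \<alpha>\<bar> *
    (K * ((\<Prod>i\<in>UNIV. weight N (?lk \<alpha> i) + h) - (\<Prod>i\<in>UNIV. weight N (?lk \<alpha> i)))))" for h
  have "(H \<longlongrightarrow> H 0) (at_right 0)"
    unfolding H_def by (intro tendsto_intros)
  then have "(H \<longlongrightarrow> 0) (at_right 0)" by (simp add: H_def)
  then have "eventually (\<lambda>h. H h < e \<and> h > 0) (at_right 0)"
    using e by (intro eventually_conj order_tendstoD(2) eventually_at_right_less)
  then obtain h where h: "H h < e" "h > 0"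
    using eventually_happens[of _ "at_right (0::real)"] trivial_limit_at_right_real by blast
  obtain T and P :: "(real \<times> real set) set" and c y s
    where *: "finite P \<and> (\<forall>j\<in>P. c j \<ge> 0) \<and> (\<forall>j l. l > T \<longrightarrow> s j l = 0) \<and> d \<le> 2 * T \<and>
      (\<forall>b\<le>d. (\<Sum>l\<le>2 * T. weight N l *
       \<bar>(\<Sum>j\<in>P. c j * y j ^ b * sq_coeff (s j) l) - of_bool (l = b)\<bar>) \<le> h)"
    using univariate_quadrature[OF \<open>N \<ge> 1\<close> h(2), of d] by (elim exE) (rule that)
  then have fin: "finite P" and c: "\<And>j. j \<in> P \<Longrightarrow> c j \<ge> 0"
    and s: "\<And>j l. l > T \<Longrightarrow> s j l = 0" and T: "d \<le> 2 * T"
    and small: "\<And>b. b \<le> d \<Longrightarrow> (\<Sum>l\<le>2 * T. weight N l *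
       \<bar>(\<Sum>j\<in>P. c j * y j ^ b * sq_coeff (s j) l) - of_bool (l = b)\<bar>) \<le> h"
    by (simp_all del: split_paired_All)
  define u where "u b l = (\<Sum>j\<in>P. c j * y j ^ b * sq_coeff (s j) l)" for b l
  define S :: "_ \<Rightarrow> 'n \<Rightarrow> 'n rpoly" where "S j i = (\<Sum>l\<le>T. Const (s j l) * Var i ^ l) ^ 2" for j i
  have S_eq: "S j i = (\<Sum>l\<le>2 * T. Const (sq_coeff (s j) l) * Var i ^ l)" for j i
    unfolding S_def by (rule power2_sum_powers) (rule s)
  define F where "F = (PiE UNIV (\<lambda>_. P) :: ('n \<Rightarrow> _) set)"
  \<comment> \<open>A tuple \<open>\<phi>\<close> assigns a node to every variable, hence a point at
    which \<open>p\<close> is evaluated; nonnegativity of \<open>p\<close> makes the coefficients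
    nonnegative.\<close>
  define A where "A = (\<Sum>\<phi>\<in>F. Const (eval p (\<chi> i. y (\<phi> i)) * (\<Prod>i\<in>UNIV. c (\<phi> i))) * (\<Prod>i\<in>UNIV. S (\<phi> i) i))"
  have "sum_of_squares A"
    unfolding A_def
  proof (intro sum_of_squares_sum sum_of_squares_mult sum_of_squares_prod sum_of_squares_Const mult_nonneg_nonneg p prod_nonneg)
    show "sum_of_squares (S j i)" for i j unfolding S_def by (rule sum_of_squares_square)
  qed (auto simp: F_def intro: c)
  \<comment> \<open>Expanding over tuples of nodes the product of the univariate approximations to
    \<open>Var i ^ a i\<close> shows that \<open>A\<close> arises from \<open>p\<close> by replacing
    each monomial with this product.\<close>
  have prod_eq: "(\<Prod>i\<in>UNIV. \<Sum>l\<le>2 * T. Const (u (a i) l) * Var i ^ l)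
    = (\<Sum>\<phi>\<in>F. Const ((\<Prod>i\<in>UNIV. y (\<phi> i) ^ a i) * (\<Prod>i\<in>UNIV. c (\<phi> i))) * (\<Prod>i\<in>UNIV. S (\<phi> i) i))" for a
  proof -
    have "(\<Sum>l\<le>2 * T. Const (u (a i) l) * Var i ^ l) = (\<Sum>j\<in>P. Const (c j * y j ^ a i) * S j i)" for i
      unfolding S_eq u_def Const_sum sum_distrib_right sum_distrib_left
      by (subst sum.swap) (simp add: Const_mult mult_ac)
    then show ?thesis
      unfolding F_def using fin
      by (simp add: prod_sum_PiE prod.distrib Const_mult Const_prod mult_ac)
  qed
  have "A = (\<Sum>\<alpha>\<in>?M. Const (?lk p \<alpha>) * (\<Prod>i\<in>UNIV. \<Sum>l\<le>2 * T. Const (u (?lk \<alpha> i) l) * Var i ^ l))"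
    unfolding A_def prod_eq eval_def sum_distrib_left sum_distrib_right Const_sum
    by (subst sum.swap) (simp add: Const_mult mult_ac)
  then have "p - A = (\<Sum>\<alpha>\<in>?M. Const (?lk p \<alpha>) *
    ((\<Prod>i\<in>UNIV. Var i ^ ?lk \<alpha> i) - (\<Prod>i\<in>UNIV. \<Sum>l\<le>2 * T. Const (u (?lk \<alpha> i) l) * Var i ^ l)))"
    by (subst rpoly_eq_sum_monomials[of p]) (simp add: sum_subtractf right_diff_distrib)
  also have "absorbed (H h) \<dots>"
    unfolding H_def K_def N_def
  proof (intro absorbed_sum absorbed_prod_diff)
    fix \<alpha> i assume \<alpha>: "\<alpha> \<in> ?M"
    show "?lk \<alpha> i \<le> 2 * T" using d[OF \<alpha>] T by (rule order_trans)
    show "(\<Sum>l\<le>2 * T. weight CARD('n) l * \<bar>u (?lk \<alpha> i) l - of_bool (l = ?lk \<alpha> i)\<bar>) \<le> h"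
      using small[OF d[OF \<alpha>]] by (simp add: u_def N_def)
  qed
  finally have "absorbed e (p - A)" by (rule absorbed_mono) (use h in simp)
  then obtain r where "sum_of_squares ((p - A) + Const e * perturbation r)"
    unfolding absorbed_def by blast
  from sum_of_squares_add[OF \<open>sum_of_squares A\<close> this] show ?thesis
    by (auto simp: algebra_simps)
qed

theorem corollary4p3:
  fixes m :: nat
    and g :: "nat \<Rightarrow> 'n::finite rpoly"
    and f :: "'n rpoly"
  assumes concave: "\<forall>j\<in>{1..m}. concave_on UNIV (eval (g j))"
    and slater: "\<exists>x0\<in>feasible_set m g. \<forall>j\<in>{1..m}. eval (g j) x0 > 0"
    and convex: "convex_on UNIV (eval f)"
    and nonneg: "\<forall>x\<in>feasible_set m g. eval f x \<ge> 0"
    and minimizer: "\<exists>xs\<in>feasible_set m g. \<forall>x\<in>feasible_set m g. eval f xs \<le> eval f x"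
  shows "\<exists>l :: nat \<Rightarrow> real. (\<forall>j\<in>{1..m}. l j \<ge> 0) \<and>
    (\<forall>\<epsilon>>0. \<exists>r :: nat. \<exists>f0 :: 'n rpoly. sum_of_squares f0 \<and>
       f + Const \<epsilon> * (\<Sum>k=0..r. \<Sum>i\<in>UNIV. Const (1 / fact k) * Var i ^ (2 * k))
         = f0 + (\<Sum>j=1..m. Const (l j) * g j) \<and>
       total_degree f0 \<le>
         Max (insert (2 * r) (insert (total_degree f) ((\<lambda>j. total_degree (g j)) ` {1..m}))))"
proof -
  obtain x0 where x0: "\<And>j. j \<in> {1..m} \<Longrightarrow> eval (g j) x0 > 0" using slater by blast
  have "\<exists>l. (\<forall>j. l j \<ge> 0) \<and> (\<forall>x\<in>UNIV. eval f x \<ge> (\<Sum>j=1..m. l j * eval (g j) x))"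
    by (rule lagrange_multipliers[OF convex, where z = x0])
      (use concave x0 nonneg in \<open>auto simp: feasible_set_def\<close>)
  then obtain l where l: "\<And>j. l j \<ge> 0" "\<And>x. eval f x \<ge> (\<Sum>j=1..m. l j * eval (g j) x)"
    by blast
  \<comment> \<open>The multipliers come from \<open>f\<close> and \<open>g\<close> alone, so they
    are fixed before \<open>e\<close> is introduced.\<close>
  define G where "G = (\<Sum>j=1..m. Const (l j) * g j)"
  have nn: "eval (f - G) x \<ge> 0" for x
    using l(2)[of x] by (simp add: G_def eval_diff eval_sum eval_Const_mult)
  show ?thesis
  proof (intro exI[of _ l] conjI ballI allI impI)
    fix e :: real assume "e > 0"
    then obtain r where r: "sum_of_squares (f - G + Const e * perturbation r)"
      using sum_of_squares_perturbation[OF nn] by blast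
    define f0 where "f0 = f - G + Const e * perturbation r"
    define D where "D = Max (insert (2 * r) (insert (total_degree f) ((\<lambda>j. total_degree (g j)) ` {1..m})))"
    have D: "2 * r \<le> D" "total_degree f \<le> D" "\<And>j. j \<in> {1..m} \<Longrightarrow> total_degree (g j) \<le> D"
      unfolding D_def by (rule Max_ge; simp)+
    have "total_degree (perturbation r :: 'n rpoly) \<le> D"
      unfolding perturbation_def power_sum_def
      by (intro total_degree_sum_le total_degree_Const_mult_le order_trans[OF total_degree_Var_power_le])
        (use D in auto)
    then have "total_degree f0 \<le> D"
      unfolding f0_def G_def
      by (intro total_degree_add_le total_degree_diff_le total_degree_sum_le total_degree_Const_mult_le D)
    moreover have "f + Const e * (\<Sum>k=0..r. \<Sum>i\<in>UNIV. Const (1 / fact k) * Var i ^ (2 * k)) = f0 + G"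
      by (simp add: f0_def perturbation_def power_sum_def sum_distrib_left)
    ultimately show "\<exists>r f0. sum_of_squares f0 \<and>
       f + Const e * (\<Sum>k=0..r. \<Sum>i\<in>UNIV. Const (1 / fact k) * Var i ^ (2 * k))
         = f0 + (\<Sum>j=1..m. Const (l j) * g j) \<and>
       total_degree f0 \<le>
         Max (insert (2 * r) (insert (total_degree f) ((\<lambda>j. total_degree (g j)) ` {1..m})))"
      using r unfolding G_def D_def f0_def by blast
  qed (use l in auto)
qed

end
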